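(* Let $\Lambda$ be a $\sigma$-compact metric space, let $\sigma$ be a diffuse positive Radon measure on $\Lambda$ with $0<\sigma(\Lambda)<\infty$, and let $\mu_\sigma$ be the Poisson measure of intensity $\sigma$ on $\Gamma_\Lambda$. Let $h_{\mu_\sigma}$ be the isoperimetric constant $$h_{\mu_\sigma}=\inf_{A\in\mathcal{B}(\Gamma_\Lambda),\;0<\mu_\sigma(A)<1}\;\frac{\mu_\sigma(\partial A)}{\mu_\sigma(A)\,(1-\mu_\sigma(A))}.$$ Then $$1\le h_{\mu_\sigma}\le\frac{\sigma(\Lambda)}{1-e^{-\sigma(\Lambda)}}.$$ In particular, $h_{\mu_\sigma}\to1$ as $\sigma(\Lambda)\to0$.
   Context: $\Gamma_\Lambda=\{\omega\subset\Lambda : \omega\cap K \text{ is finite for every compact } K\}$ is the configuration space, with $\omega$ identified with the Radon measure $\sum_{x\in\omega}\varepsilon_x$ (sum of Dirac masses). It carries the vague topology and its Borel $\sigma$-algebra $\mathcal{B}(\Gamma_\Lambda)$. The Poisson measure $\mu_\sigma$ is characterized by $\mathbb{E}_{\mu_\sigma}[\exp(\int_\Lambda f\,d\omega)]=\exp\{\int_\Lambda(e^f-1)\,d\sigma\}$ for all continuous compactly supported $f$. The discrete gradient is $\nabla^\sharp_xF(\omega)=F(\omega+\varepsilon_x)-F(\omega)$, and the surface measure of $A\in\mathcal{B}(\Gamma_\Lambda)$ is $$\mu_\sigma(\partial A):=\mathbb{E}_{\mu_\sigma}\left[\int_\Lambda|\nabla^\sharp_x\mathbf 1_A|\,d\s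igma(x)\right].$$
   Formalization: Λ is additionally assumed locally compact; without this the claim can fail, e.g. for the span of an infinite-dimensional compact convex set in ℓ² with length measure on a segment: no nonzero compactly supported continuous f exists, B(Γ_Λ) is trivial and h is the infimum of the empty set. *)

theory Defs
  imports "HOL-Probability.Probability"
begin

definition sigma_compact :: "'a::topological_space set \<Rightarrow> bool" where
  "sigma_compact S \<longleftrightarrow> (\<exists>K::nat \<Rightarrow> 'a set. (\<forall>n. compact (K n)) \<and> (\<Union>n. K n) = S)"

definition radon_measure :: "'a::metric_space measure \<Rightarrow> bool" where
  "radon_measure \<sigma> \<longleftrightarrow>
     sets \<sigma> = sets borel \<and>
     (\<forall>x. \<exists>U. open U \<and> x \<in> U \<and> emeasure \<sigma> U < \<infinity>) \<and>
     (\<forall>B \<in> sets borel. emeasure \<sigma> B = (SUP K \<in> {K. compact K \<and> K \<subseteq> B}. emeasure \<sigma> K))"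

definition diffuse :: "'a measure \<Rightarrow> bool" where
  "diffuse \<sigma> \<longleftrightarrow> (\<forall>x \<in> space \<sigma>. emeasure \<sigma> {x} = 0)"

definition compactly_supported :: "('a::metric_space \<Rightarrow> real) \<Rightarrow> bool" where
  "compactly_supported f \<longleftrightarrow> compact (closure {x. f x \<noteq> 0})"

definition configurations :: "'a::metric_space set set" where
  "configurations = {\<omega>. \<forall>K. compact K \<longrightarrow> finite (\<omega> \<inter> K)}"

(* The sum of the Dirac masses at the points of \<omega>, as a Borel measure:
   a Borel set B has mass card (\<omega> \<inter> B), see emeasure_dirac_sum. *)
definition dirac_sum :: "'a::metric_space set \<Rightarrow> 'a measure" where
  "dirac_sum \<omega> = distr (count_space \<omega>) borel (\<lambda>x. x)"

lemma emeasure_dirac_sum: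
  assumes "B \<in> sets borel"
  shows "emeasure (dirac_sum \<omega>) B = emeasure (count_space UNIV) (\<omega> \<inter> B)"
proof -
  have "emeasure (dirac_sum \<omega>) B = emeasure (count_space \<omega>) ((\<lambda>x. x) -` B \<inter> space (count_space \<omega>))"
    unfolding dirac_sum_def by (rule emeasure_distr[OF _ assms]) simp
  also have "\<dots> = emeasure (count_space \<omega>) (\<omega> \<inter> B)"
    by (simp add: Int_commute)
  also have "\<dots> = emeasure (count_space UNIV) (\<omega> \<inter> B)"
    by (subst (1 2) emeasure_count_space) auto
  finally show ?thesis .
qed

definition vague_topology :: "'a::metric_space set topology" where
  "vague_topology = topology_generated_by
     {{\<omega> \<in> configurations. integral\<^sup>L (dirac_sum \<omega>) f \<in> U} | f U.
        continuous_on UNIV f \<and> compactly_supported f \<and> open U}"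

lemma topspace_vague_topology:
  "topspace vague_topology = (configurations :: 'a::metric_space set set)"
proof -
  have "compactly_supported (\<lambda>_::'a. 0)"
    by (simp add: compactly_supported_def)
  then have "\<exists>(f::'a \<Rightarrow> real) U.
      configurations = {\<omega> \<in> configurations. integral\<^sup>L (dirac_sum \<omega>) f \<in> U} \<and>
      continuous_on UNIV f \<and> compactly_supported f \<and> open U"
    by (intro exI[of _ "\<lambda>_. 0"] exI[of _ UNIV]) simp
  then show ?thesis
    unfolding vague_topology_def topology_generated_by_topspace by blast
qed

definition vague_borel :: "'a::metric_space set measure" where
  "vague_borel = sigma configurations {U. openin vague_topology U}"

(* The right-hand side below is positive, whereas the Bochner integral of a
   non-integrable function is 0, so the equation includes integrability on the left. *)
definition is_poisson_measure :: "'a::metric_space measure \<Rightarrow> 'a set measure \<Rightarrow> bool" where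
  "is_poisson_measure \<sigma> \<mu> \<longleftrightarrow>
     prob_space \<mu> \<and> sets \<mu> = sets vague_borel \<and>
     (\<forall>f. continuous_on UNIV f \<longrightarrow> compactly_supported f \<longrightarrow>
        (\<integral>\<omega>. exp (integral\<^sup>L (dirac_sum \<omega>) f) \<partial>\<mu>) = exp (\<integral>x. (exp (f x) - 1) \<partial>\<sigma>))"

(* Adding the Dirac mass at x to \<omega> is inserting x. This is literal for x not in \<omega>;
   the points of \<omega> form a null set of a diffuse \<sigma>, so their treatment does not
   affect the surface measure. *)
definition discrete_gradient :: "'a \<Rightarrow> ('a set \<Rightarrow> real) \<Rightarrow> 'a set \<Rightarrow> real" where
  "discrete_gradient x F \<omega> = F (insert x \<omega>) - F \<omega>"

definition surface_measure :: "'a measure \<Rightarrow> 'a set measure \<Rightarrow> 'a set set \<Rightarrow> ennreal" where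
  "surface_measure \<sigma> \<mu> A =
     (\<integral>\<^sup>+\<omega>. (\<integral>\<^sup>+x. ennreal \<bar>discrete_gradient x (indicat_real A) \<omega>\<bar> \<partial>\<sigma>) \<partial>\<mu>)"

definition isoperimetric_constant :: "'a measure \<Rightarrow> 'a set measure \<Rightarrow> ennreal" where
  "isoperimetric_constant \<sigma> \<mu> =
     (INF A \<in> {A \<in> sets \<mu>. 0 < measure \<mu> A \<and> measure \<mu> A < 1}.
        surface_measure \<sigma> \<mu> A / ennreal (measure \<mu> A * (1 - measure \<mu> A)))"

end

theory Submission
  imports Defs "HOL-Real_Asymp.Real_Asymp"
begin

text \<open>Write \<open>s = \<sigma>(\<Lambda>)\<close> and \<open>\<pi> = \<sigma> / s\<close>. Under \<open>\<mu>\<close> the configuration consists of \<open>N\<close> independent points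
with law \<open>\<pi>\<close>, where \<open>N\<close> is Poisson distributed with parameter \<open>s\<close>: that process has the Laplace
functional by which \<open>\<mu>\<close> is characterized, and the Laplace functional determines a law on the Borel
sets of the vague topology (\<open>Laplace_functional_unique\<close>, \<open>poisson_measure_eq_mixture\<close>).

The lower bound is the Poincare inequality \<open>Var F \<le> E \<integral> (D\<^sub>x F)\<^sup>2 d\<sigma>(x)\<close> for \<open>F\<close> the indicator of \<open>A\<close>; here
\<open>D\<^sub>x F\<close> takes the values \<open>-1\<close>, \<open>0\<close>, \<open>1\<close>, so its square is its absolute value and the right-hand side
is the surface measure. Let \<open>F\<^sub>n\<close> be the value of \<open>F\<close> on the first \<open>n\<close> points and \<open>a\<^sub>n = E F\<^sub>n\<close>.
Conditioning on \<open>N\<close> splits the variance into \<open>E Var (F\<^sub>N | N)\<close> and \<open>Var a\<^sub>N\<close>.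
The first part is controlled by the Efron-Stein inequality, \<open>Var F\<^sub>n \<le> n V\<^bsub>n-1\<^esub>\<close>
(\<open>efron_stein_iid_points\<close>), where \<open>V\<^sub>n\<close> is the mean variance of \<open>F\<^bsub>n+1\<^esub>\<close> over its last point. The
second is controlled by the Poincare inequality of the Poisson law on the natural numbers,
\<open>Var a\<^sub>N \<le> s E (a\<^bsub>N+1\<^esub> - a\<^sub>N)\<^sup>2\<close> (\<open>poisson_poincare_nat\<close>). Since \<open>E N g(N) = s E g(N+1)\<close>, the sum is at most
\<open>s E [V\<^sub>N + (a\<^bsub>N+1\<^esub> - a\<^sub>N)\<^sup>2]\<close>. Finally, for fixed \<open>n\<close>, the mean square of \<open>F\<^bsub>n+1\<^esub> - F\<^sub>n\<close> over the last point is the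
variance of \<open>F\<^bsub>n+1\<^esub>\<close> over that point plus the square of its mean deviation from \<open>F\<^sub>n\<close>, so by Jensen it
dominates the bracket (\<open>mean_flip_iid_points\<close>).

For the upper bound take for \<open>A\<close> the event that there are no points. It has probability \<open>exp (-s)\<close>, and
\<open>D\<^sub>x\<close> of its indicator is \<open>-1\<close> on the empty configuration and \<open>0\<close> elsewhere, so its surface
measure is \<open>s exp (-s)\<close>. As \<open>s\<close> tends to \<open>0\<close>, the two bounds meet at \<open>1\<close>.\<close>

section \<open>Configurations as linear functionals on test functions\<close>

definition test_function :: "('a::metric_space \<Rightarrow> real) \<Rightarrow> bool" where
  "test_function f \<longleftrightarrow> continuous_on UNIV f \<and> compactly_supported f"

abbreviation pairing :: "('a::metric_space \<Rightarrow> real) \<Rightarrow> 'a set \<Rightarrow> real" where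
  "pairing f \<omega> \<equiv> integral\<^sup>L (dirac_sum \<omega>) f"

lemma test_function_borel: "test_function f \<Longrightarrow> f \<in> borel_measurable borel"
  by (simp add: test_function_def borel_measurable_continuous_onI)

lemma test_functionI:
  assumes "continuous_on UNIV f" "compact K" "\<And>x. x \<notin> K \<Longrightarrow> f x = 0"
  shows "test_function f"
proof -
  have "closure {x. f x \<noteq> 0} \<subseteq> K"
    using assms(2,3) by (intro closure_minimal) (auto intro: compact_imp_closed)
  then have "compact (closure {x. f x \<noteq> 0})"
    using assms(2) by (metis closed_closure compact_Int_closed inf.absorb_iff2)
  then show ?thesis
    using assms(1) by (simp add: test_function_def compactly_supported_def)
qed

lemma test_function_support:
  assumes "test_function f"
  obtains K where "compact K" "\<And>x. x \<notin> K \<Longrightarrow> f x = 0"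
proof (rule that)
  show "compact (closure {x. f x \<noteq> 0})"
    using assms by (simp add: test_function_def compactly_supported_def)
  show "f x = 0" if "x \<notin> closure {x. f x \<noteq> 0}" for x
    using that closure_subset[of "{x. f x \<noteq> 0}"] by auto
qed

lemma test_function_scale:
  assumes "test_function f"
  shows "test_function (\<lambda>x. c * f x)"
proof -
  obtain K where K: "compact K" "\<And>x. x \<notin> K \<Longrightarrow> f x = 0"
    using test_function_support[OF assms] by blast
  show ?thesis
    using assms by (intro test_functionI[OF _ K(1)])
      (auto simp: K(2) test_function_def intro!: continuous_intros)
qed

lemma test_function_add:
  assumes "test_function f" "test_function g"
  shows "test_function (\<lambda>x. f x + g x)"
proof -
  obtain K where K: "compact K" "\<And>x. x \<notin> K \<Longrightarrow> f x = 0"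
    using test_function_support[OF assms(1)] by blast
  obtain L where L: "compact L" "\<And>x. x \<notin> L \<Longrightarrow> g x = 0"
    using test_function_support[OF assms(2)] by blast
  show ?thesis
    using assms by (intro test_functionI[OF _ compact_Un[OF K(1) L(1)]])
      (auto simp: K(2) L(2) test_function_def intro!: continuous_intros)
qed

text \<open>A test function has only finitely many nonzero values on a configuration, so the integral against
the sum of Dirac masses is a finite sum. The set \<open>T\<close> may be larger than the set of nonzero values,
which allows several functions to be summed over the same set.\<close>

lemma pairing_eq_sum:
  assumes "test_function f" "finite T" "T \<subseteq> \<omega>" "\<And>x. x \<in> \<omega> - T \<Longrightarrow> f x = 0"
  shows "pairing f \<omega> = (\<Sum>x\<in>T. f x)"
proof -
  have sub: "{x \<in> \<omega>. f x \<noteq> 0} \<subseteq> T"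
    using assms(4) by auto
  have "pairing f \<omega> = integral\<^sup>L (count_space \<omega>) f"
    unfolding dirac_sum_def by (rule integral_distr) (simp_all add: test_function_borel[OF assms(1)])
  also have "\<dots> = (\<Sum>x | x \<in> \<omega> \<and> f x \<noteq> 0. f x)"
    by (rule lebesgue_integral_count_space_finite_support) (rule finite_subset[OF sub assms(2)])
  also have "\<dots> = (\<Sum>x\<in>T. f x)"
    using assms(2,3) sub by (intro sum.mono_neutral_left) auto
  finally show ?thesis .
qed

lemma configuration_support:
  assumes "test_function f" "\<omega> \<in> configurations"
  shows "finite {x \<in> \<omega>. f x \<noteq> 0}"
proof -
  obtain K where K: "compact K" "\<And>x. x \<notin> K \<Longrightarrow> f x = 0"
    using test_function_support[OF assms(1)] by blast
  have "finite (\<omega> \<inter> K)"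
    using assms(2) K(1) by (simp add: configurations_def)
  then show ?thesis
    by (rule finite_subset[rotated]) (use K(2) in auto)
qed

lemma pairing_integrable:
  assumes "test_function f" "\<omega> \<in> configurations"
  shows "integrable (dirac_sum \<omega>) f"
proof -
  have "integrable (count_space \<omega>) f"
    using configuration_support[OF assms] by (simp add: integrable_iff_bounded nn_integral_count_space)
  then show ?thesis
    unfolding dirac_sum_def by (subst integrable_distr_eq) (simp_all add: test_function_borel[OF assms(1)])
qed

lemma pairing_nonneg: "(\<And>x. 0 \<le> f x) \<Longrightarrow> 0 \<le> pairing f \<omega>"
  by simp

lemma pairing_add:
  "test_function f \<Longrightarrow> test_function g \<Longrightarrow> \<omega> \<in> configurations \<Longrightarrow>
     pairing (\<lambda>x. f x + g x) \<omega> = pairing f \<omega> + pairing g \<omega>"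
  by (simp add: pairing_integrable)

lemma empty_configuration: "{} \<in> configurations"
  by (simp add: configurations_def)

lemma insert_configuration: "\<omega> \<in> configurations \<Longrightarrow> insert x \<omega> \<in> configurations"
  by (simp add: configurations_def Int_insert_left)

text \<open>A configuration is a set and not a multiset: adding a point that is already there changes nothing.\<close>

lemma pairing_insert:
  assumes "test_function f" "\<omega> \<in> configurations"
  shows "pairing f (insert x \<omega>) = pairing f \<omega> + (if x \<in> \<omega> then 0 else f x)"
proof (cases "x \<in> \<omega>")
  case False
  let ?T = "{x \<in> \<omega>. f x \<noteq> 0}"
  have fin: "finite ?T"
    by (rule configuration_support[OF assms])
  have "pairing f (insert x \<omega>) = (\<Sum>y\<in>insert x ?T. f y)"
    using fin by (intro pairing_eq_sum[OF assms(1)]) auto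
  moreover have "pairing f \<omega> = (\<Sum>y\<in>?T. f y)"
    using fin by (intro pairing_eq_sum[OF assms(1)]) auto
  ultimately show ?thesis
    using False fin by (simp add: add.commute)
qed (simp add: insert_absorb)

lemma pairing_pos_iff:
  assumes "test_function f" "\<omega> \<in> configurations" "\<And>x. 0 \<le> f x"
  shows "0 < pairing f \<omega> \<longleftrightarrow> (\<exists>x\<in>\<omega>. 0 < f x)"
proof -
  let ?T = "{x \<in> \<omega>. f x \<noteq> 0}"
  have fin: "finite ?T"
    by (rule configuration_support[OF assms(1,2)])
  have eq: "pairing f \<omega> = (\<Sum>y\<in>?T. f y)"
    using fin by (intro pairing_eq_sum[OF assms(1)]) auto
  show ?thesis
  proof
    assume "0 < pairing f \<omega>"
    then have "?T \<noteq> {}"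
      unfolding eq by (metis less_irrefl sum.empty)
    then show "\<exists>x\<in>\<omega>. 0 < f x"
      using assms(3) by (auto simp: order.strict_iff_order)
  next
    assume "\<exists>x\<in>\<omega>. 0 < f x"
    then obtain x where "x \<in> ?T" "0 < f x"
      by force
    then show "0 < pairing f \<omega>"
      unfolding eq using fin assms(3) by (intro sum_pos2) auto
  qed
qed

section \<open>Countably many test functions\<close>

definition bump :: "'a::metric_space \<times> real \<Rightarrow> 'a \<Rightarrow> real" where
  "bump b x = max 0 (snd b - dist x (fst b))"

text \<open>A ball is given by its centre and radius. The last clause says that every point lies in balls of the
family of arbitrarily small radius.\<close>

definition ball_basis :: "('a::metric_space \<times> real) set \<Rightarrow> bool" where
  "ball_basis B \<longleftrightarrow> countable B \<and> (\<forall>(c, r)\<in>B. 0 < r \<and> compact (cball c r)) \<and>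
     (\<forall>x. \<forall>e>0. \<exists>(c, r)\<in>B. dist x c < r \<and> r < e)"

lemma bump_nonneg: "0 \<le> bump b x"
  by (simp add: bump_def)

lemma bump_pos_iff: "0 < bump b x \<longleftrightarrow> dist x (fst b) < snd b"
  by (auto simp: bump_def)

lemma continuous_on_bump: "continuous_on UNIV (bump b)"
  unfolding bump_def by (intro continuous_intros)

lemma ball_basis_compact: "ball_basis B \<Longrightarrow> b \<in> B \<Longrightarrow> compact (cball (fst b) (snd b))"
  by (auto simp: ball_basis_def)

lemma test_function_bump: "ball_basis B \<Longrightarrow> b \<in> B \<Longrightarrow> test_function (bump b)"
  by (rule test_functionI[OF continuous_on_bump ball_basis_compact])
     (auto simp: bump_def dist_commute)

context
  assumes sc: "sigma_compact (UNIV :: 'a::metric_space set)"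
    and lc: "locally compact (UNIV :: 'a set)"
begin

text \<open>Some closed ball around each point is compact, although closed balls of a locally compact metric
space need not be compact.\<close>

lemma compact_cball_exists:
  obtains r where "0 < r" "compact (cball (x::'a) r)"
proof -
  obtain u v where uv: "openin (top_of_set UNIV) u" "compact v" "x \<in> u" "u \<subseteq> v"
    using lc unfolding locally_def by (metis UNIV_I openin_topspace topspace_euclidean_subtopology)
  then obtain r where r: "0 < r" "cball x r \<subseteq> u"
    by (metis open_contains_cball open_openin subtopology_UNIV)
  then have "cball x r \<subseteq> v"
    using uv by blast
  then have "compact (cball x r)"
    using uv(2) by (metis closed_cball compact_Int_closed inf.absorb_iff2)
  then show ?thesis
    using r(1) that by blast
qed

lemma configurations_countable:
  assumes "(\<omega>::'a set) \<in> configurations"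
  shows "countable \<omega>"
proof -
  obtain K :: "nat \<Rightarrow> 'a set" where K: "\<And>n. compact (K n)" "(\<Union>n. K n) = UNIV"
    using sc by (auto simp: sigma_compact_def)
  have "\<omega> = (\<Union>n. \<omega> \<inter> K n)"
    using K(2) by blast
  moreover have "countable (\<Union>n. \<omega> \<inter> K n)"
    using assms K(1) by (intro countable_UN) (auto simp: configurations_def intro: countable_finite)
  ultimately show ?thesis
    by simp
qed

lemma ball_basis_exists:
  obtains B where "ball_basis (B :: ('a \<times> real) set)"
proof -
  obtain K :: "nat \<Rightarrow> 'a set" where K: "\<And>n. compact (K n)" "(\<Union>n. K n) = UNIV"
    using sc by (auto simp: sigma_compact_def)
  have "\<exists>k. finite k \<and> K n \<subseteq> (\<Union>x\<in>k. ball x (1 / Suc m))" for n m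
    using K(1)[of n] unfolding compact_eq_totally_bounded by simp
  then obtain N where N: "\<And>n m. finite (N n m)" "\<And>n m. K n \<subseteq> (\<Union>x\<in>N n m. ball x (1 / Suc m))"
    by metis
  define C where "C = (\<Union>n m. N n m)"
  define B where "B = {b \<in> C \<times> range (\<lambda>m::nat. 1 / Suc m). compact (cball (fst b) (snd b))}"
  have "countable C"
    unfolding C_def using N(1) by (intro countable_UN) (auto intro: countable_finite)
  then have "countable B"
    unfolding B_def by (intro countable_Collect countable_SIGMA) auto
  moreover have "\<exists>(c, r)\<in>B. dist x c < r \<and> r < e" if e: "0 < e" for x and e :: real
  proof -
    obtain r where r: "0 < r" "compact (cball x r)"
      by (rule compact_cball_exists)
    obtain m where m: "1 / Suc m < min e (r / 2)"
      using e r(1) by (metis half_gt_zero min_less_iff_conj nat_approx_posE)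
    obtain n where "x \<in> K n"
      using K(2) by blast
    then obtain c where c: "c \<in> N n m" "dist c x < 1 / Suc m"
      using N(2)[of n m] by auto
    have "cball c (1 / Suc m) \<subseteq> cball x r"
    proof
      fix y assume "y \<in> cball c (1 / Suc m)"
      then have "dist x y \<le> 1 / Suc m + 1 / Suc m"
        using c(2) dist_triangle[of x y c] by (simp add: dist_commute)
      then show "y \<in> cball x r"
        using m by simp
    qed
    then have "compact (cball c (1 / Suc m))"
      using r(2) by (metis closed_cball compact_Int_closed inf.absorb_iff2)
    then have "(c, 1 / Suc m) \<in> B"
      using c(1) by (auto simp: B_def C_def)
    then show ?thesis
      using c(2) m by (intro bexI[of _ "(c, 1 / Suc m)"]) (auto simp: dist_commute)
  qed
  ultimately have "ball_basis B"
    unfolding ball_basis_def by (auto simp: B_def)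
  then show ?thesis
    by (rule that)
qed

lemma compact_thickening:
  assumes "compact (K :: 'a set)"
  obtains r K' where "0 < r" "compact K'" "\<And>x. x \<in> K \<Longrightarrow> cball x r \<subseteq> K'"
proof -
  define \<rho> where "\<rho> x = (SOME r. 0 < r \<and> compact (cball x r))" for x :: 'a
  have \<rho>: "0 < \<rho> x \<and> compact (cball x (\<rho> x))" for x
    unfolding \<rho>_def by (rule someI_ex) (metis compact_cball_exists)
  have "K \<subseteq> (\<Union>x\<in>K. ball x (\<rho> x / 2))"
    using \<rho> by force
  then obtain F where F: "F \<subseteq> K" "finite F" "K \<subseteq> (\<Union>x\<in>F. ball x (\<rho> x / 2))"
    using compactE_image[OF assms, of K "\<lambda>x. ball x (\<rho> x / 2)"] by auto
  define r where "r = Min (insert 1 ((\<lambda>x. \<rho> x / 2) ` F))"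
  have r: "r \<le> \<rho> x / 2" if "x \<in> F" for x
    unfolding r_def using F(2) that by (intro Min_le) auto
  have "0 < r"
    unfolding r_def using F(2) \<rho> by (subst Min_gr_iff) auto
  moreover have "compact (\<Union>x\<in>F. cball x (\<rho> x))"
    using F(2) \<rho> by (intro compact_UN) auto
  moreover have "cball x r \<subseteq> (\<Union>x\<in>F. cball x (\<rho> x))" if x: "x \<in> K" for x
  proof
    fix y assume y: "y \<in> cball x r"
    obtain z where z: "z \<in> F" "dist z x < \<rho> z / 2"
      using F(3) x unfolding subset_iff UN_iff mem_ball by blast
    have "dist z y \<le> \<rho> z"
      using z y r[OF z(1)] dist_triangle[of z y x] by simp
    then show "y \<in> (\<Union>x\<in>F. cball x (\<rho> x))"
      using z(1) by auto
  qed
  ultimately show ?thesis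
    by (rule that)
qed

end

text \<open>Dividing by the sum of all bumps would give a partition of unity on the union of the balls, but a
discontinuous one at its boundary. With the maximum the functions are continuous, sum up to at most
\<open>1\<close>, and still sum up to \<open>1\<close> wherever the sum of the bumps is at least \<open>1 / Suc k\<close>. All of them are
indexed by countably many parameters \<open>F\<close>, \<open>k\<close>, \<open>b\<close>.\<close>

definition bump_part :: "('a::metric_space \<times> real) set \<Rightarrow> nat \<Rightarrow> 'a \<times> real \<Rightarrow> 'a \<Rightarrow> real" where
  "bump_part F k b x = bump b x / max (1 / Suc k) (\<Sum>b'\<in>F. bump b' x)"

lemma bump_part_nonneg: "0 \<le> bump_part F k b x"
  unfolding bump_part_def by (intro divide_nonneg_nonneg bump_nonneg) (simp add: le_max_iff_disj)

lemma sum_bump_part: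
  assumes "finite F"
  shows "(\<Sum>b\<in>F. bump_part F k b x) \<le> 1"
    and "1 / Suc k \<le> (\<Sum>b\<in>F. bump b x) \<Longrightarrow> (\<Sum>b\<in>F. bump_part F k b x) = 1"
proof -
  have pos: "0 < max (1 / real (Suc k)) (\<Sum>b\<in>F. bump b x)"
    by (simp add: less_max_iff_disj)
  have eq: "(\<Sum>b\<in>F. bump_part F k b x) = (\<Sum>b\<in>F. bump b x) / max (1 / Suc k) (\<Sum>b\<in>F. bump b x)"
    by (simp add: bump_part_def sum_divide_distrib)
  show "(\<Sum>b\<in>F. bump_part F k b x) \<le> 1"
    unfolding eq using pos by (subst divide_le_eq_1_pos) auto
  show "(\<Sum>b\<in>F. bump_part F k b x) = 1" if "1 / Suc k \<le> (\<Sum>b\<in>F. bump b x)"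
    unfolding eq using that pos by (auto simp: max_def)
qed

lemma test_function_bump_part:
  assumes "ball_basis B" "b \<in> B"
  shows "test_function (bump_part F k b)"
proof (rule test_functionI[OF _ ball_basis_compact[OF assms]])
  have "max (1 / real (Suc k)) (\<Sum>b'\<in>F. bump b' x) \<noteq> 0" for x
    by (metis less_max_iff_disj less_numeral_extra(3) of_nat_0_less_iff zero_less_Suc zero_less_divide_1_iff)
  then show "continuous_on UNIV (bump_part F k b)"
    unfolding bump_part_def
    by (intro continuous_on_divide continuous_on_bump continuous_on_max continuous_on_const continuous_on_sum) auto
  show "bump_part F k b x = 0" if "x \<notin> cball (fst b) (snd b)" for x
    using that by (simp add: bump_part_def bump_def dist_commute)
qed

text \<open>By uniform continuity, a test function is up to \<open>\<epsilon>\<close> a combination of the parts of a partition of unity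
into small balls, with its values at the centres as coefficients. The error is bounded by
\<open>\<epsilon>\<close> times the sum of the parts and not merely by \<open>\<epsilon>\<close>: integrated against a configuration this is finite,
and it is again expressed by the countably many functions. The compact set \<open>K'\<close> does not depend on
\<open>\<epsilon>\<close>, so that for a fixed configuration the sum of the parts stays bounded as \<open>\<epsilon>\<close> decreases.\<close>

lemma bump_part_approximation:
  assumes sc: "sigma_compact (UNIV :: 'a::metric_space set)"
    and lc: "locally compact (UNIV :: 'a set)"
    and B: "ball_basis (B :: ('a \<times> real) set)" and f: "test_function f"
  shows "\<exists>K'. compact K' \<and> (\<forall>\<epsilon>>0. \<exists>F k a. finite F \<and> F \<subseteq> B \<and>
           (\<forall>x. (\<Sum>b\<in>F. bump_part F k b x) \<le> indicator K' x) \<and>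
           (\<forall>x. \<bar>f x - (\<Sum>b\<in>F. a b * bump_part F k b x)\<bar> \<le> \<epsilon> * (\<Sum>b\<in>F. bump_part F k b x)))"
proof -
  obtain K where K: "compact K" "\<And>x. x \<notin> K \<Longrightarrow> f x = 0"
    using test_function_support[OF f] by blast
  obtain r K' where r: "0 < r" "compact K'" "\<And>x. x \<in> K \<Longrightarrow> cball x r \<subseteq> K'"
    using compact_thickening[OF sc lc K(1)] by metis
  have "\<exists>F k a. finite F \<and> F \<subseteq> B \<and>
           (\<forall>x. (\<Sum>b\<in>F. bump_part F k b x) \<le> indicator K' x) \<and>
           (\<forall>x. \<bar>f x - (\<Sum>b\<in>F. a b * bump_part F k b x)\<bar> \<le> \<epsilon> * (\<Sum>b\<in>F. bump_part F k b x))"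
    if \<epsilon>: "0 < \<epsilon>" for \<epsilon>
  proof -
    have "uniformly_continuous_on K' f"
      using f r(2) by (intro compact_uniformly_continuous) (auto simp: test_function_def intro: continuous_on_subset)
    then obtain \<delta> where \<delta>: "0 < \<delta>" "\<And>x y. x \<in> K' \<Longrightarrow> y \<in> K' \<Longrightarrow> dist y x < \<delta> \<Longrightarrow> \<bar>f y - f x\<bar> < \<epsilon>"
      unfolding uniformly_continuous_on_def dist_real_def using \<epsilon> by blast
    \<comment> \<open>Radius below \<open>r / 2\<close>: a ball meeting \<open>K\<close> then stays within distance \<open>r\<close> of \<open>K\<close>, hence in \<open>K'\<close>,
       where \<open>f\<close> is uniformly continuous.\<close>
    define B' where "B' = {b \<in> B. snd b < min (\<delta>) (r / 2) \<and> ball (fst b) (snd b) \<inter> K \<noteq> {}}"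
    have "K \<subseteq> (\<Union>b\<in>B'. ball (fst b) (snd b))"
    proof
      fix x assume x: "x \<in> K"
      have "0 < min \<delta> (r / 2)"
        using \<delta>(1) r(1) by simp
      then obtain c \<rho> where "(c, \<rho>) \<in> B" "dist x c < \<rho>" "\<rho> < min \<delta> (r / 2)"
        using B unfolding ball_basis_def by fast
      then show "x \<in> (\<Union>b\<in>B'. ball (fst b) (snd b))"
        using x unfolding B'_def by (intro UN_I[of "(c, \<rho>)"]) (auto simp: dist_commute)
    qed
    then obtain F where F: "F \<subseteq> B'" "finite F" "K \<subseteq> (\<Union>b\<in>F. ball (fst b) (snd b))"
      using compactE_image[OF K(1), of B' "\<lambda>b. ball (fst b) (snd b)"] by auto
    have "\<exists>k. \<forall>x\<in>K. 1 / real (Suc k) \<le> (\<Sum>b\<in>F. bump b x)"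
    proof (cases "K = {}")
      case False
      have "continuous_on K (\<lambda>x. \<Sum>b\<in>F. bump b x)"
        by (intro continuous_on_sum) (blast intro: continuous_on_subset[OF continuous_on_bump])
      then obtain x0 where x0: "x0 \<in> K" "\<And>x. x \<in> K \<Longrightarrow> (\<Sum>b\<in>F. bump b x0) \<le> (\<Sum>b\<in>F. bump b x)"
        using continuous_attains_inf[OF K(1) False] by blast
      obtain b where b: "b \<in> F" "x0 \<in> ball (fst b) (snd b)"
        using F(3) x0(1) by blast
      have "0 < bump b x0"
        using b(2) bump_pos_iff[of b x0] by (simp add: dist_commute)
      then have "0 < (\<Sum>b\<in>F. bump b x0)"
        using b(1) F(2) by (intro sum_pos2[of F b]) (auto simp: bump_nonneg)
      then obtain k where "1 / real (Suc k) < (\<Sum>b\<in>F. bump b x0)"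
        by (rule nat_approx_posE)
      then show ?thesis
        using x0(2) by (meson less_imp_le order_trans)
    qed auto
    then obtain k where k: "\<And>x. x \<in> K \<Longrightarrow> 1 / real (Suc k) \<le> (\<Sum>b\<in>F. bump b x)"
      by blast
    have near: "x \<in> K' \<and> \<bar>f x - f (fst b)\<bar> < \<epsilon>" if b: "b \<in> F" and nz: "bump_part F k b x \<noteq> 0" for b x
    proof -
      have "bump b x \<noteq> 0"
        using nz by (auto simp: bump_part_def)
      then have x: "dist x (fst b) < snd b"
        by (auto simp: bump_def)
      have b': "snd b < \<delta>" "snd b < r / 2"
        using b F(1) by (auto simp: B'_def)
      have "ball (fst b) (snd b) \<inter> K \<noteq> {}"
        using b F(1) by (auto simp: B'_def)
      then obtain y where y: "y \<in> K" "dist (fst b) y < snd b"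
        by auto
      have "dist y x \<le> r"
        using x y(2) b'(2) dist_triangle[of y x "fst b"] by (simp add: dist_commute)
      then have 1: "x \<in> K'"
        using r(3)[OF y(1)] by auto
      have "dist y (fst b) \<le> r"
        using y(2) b'(2) r(1) by (simp add: dist_commute)
      then have 2: "fst b \<in> K'"
        using r(3)[OF y(1)] by auto
      show ?thesis
        using 1 \<delta>(2)[OF 2 1] x b'(1) by simp
    qed
    have "(\<Sum>b\<in>F. bump_part F k b x) \<le> indicator K' x" for x
    proof (cases "x \<in> K'")
      case True
      then show ?thesis using sum_bump_part(1)[OF F(2), of k x] by simp
    next
      case False
      then have "\<And>b. b \<in> F \<Longrightarrow> bump_part F k b x = 0"
        using near by blast
      then show ?thesis by simp
    qed
    moreover have "\<bar>f x - (\<Sum>b\<in>F. f (fst b) * bump_part F k b x)\<bar> \<le> \<epsilon> * (\<Sum>b\<in>F. bump_part F k b x)" for x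
    proof -
      have "f x = (\<Sum>b\<in>F. f x * bump_part F k b x)"
      proof (cases "x \<in> K")
        case True
        then show ?thesis
          using sum_bump_part(2)[OF F(2) k[OF True]] by (simp flip: sum_distrib_left)
      qed (simp add: K(2))
      then have "\<bar>f x - (\<Sum>b\<in>F. f (fst b) * bump_part F k b x)\<bar> =
          \<bar>\<Sum>b\<in>F. (f x - f (fst b)) * bump_part F k b x\<bar>"
        by (simp add: left_diff_distrib sum_subtractf)
      also have "\<dots> \<le> (\<Sum>b\<in>F. \<bar>(f x - f (fst b)) * bump_part F k b x\<bar>)"
        by (rule sum_abs)
      also have "\<dots> \<le> (\<Sum>b\<in>F. \<epsilon> * bump_part F k b x)"
      proof (rule sum_mono)
        fix b assume "b \<in> F"
        then show "\<bar>(f x - f (fst b)) * bump_part F k b x\<bar> \<le> \<epsilon> * bump_part F k b x"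
          using near[of b x] bump_part_nonneg[of F k b x]
          by (cases "bump_part F k b x = 0") (auto simp: abs_mult intro!: mult_right_mono)
      qed
      finally show ?thesis
        by (simp add: sum_distrib_left)
    qed
    moreover have "F \<subseteq> B"
      using F(1) by (auto simp: B'_def)
    ultimately show ?thesis
      using F(2) by (intro exI[of _ F] exI[of _ k] exI[of _ "\<lambda>b. f (fst b)"]) blast
  qed
  then show ?thesis
    using r(2) by (intro exI[of _ K']) simp
qed

section \<open>The Borel sets of the vague topology\<close>

lemma space_vague_borel: "space (vague_borel :: 'a::metric_space set measure) = configurations"
  and sets_vague_borel: "sets (vague_borel :: 'a::metric_space set measure) =
    sigma_sets configurations {U. openin vague_topology U}"
proof -
  have "{U. openin vague_topology U} \<subseteq> Pow (configurations :: 'a set set)"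
    using openin_subset[of "vague_topology :: 'a set topology"] by (auto simp: topspace_vague_topology)
  then show "space (vague_borel :: 'a set measure) = configurations"
    and "sets (vague_borel :: 'a set measure) = sigma_sets configurations {U. openin vague_topology U}"
    by (simp_all add: vague_borel_def space_measure_of sets_measure_of)
qed

lemma pairing_measurable:
  assumes "test_function f"
  shows "pairing f \<in> borel_measurable vague_borel"
proof (rule borel_measurableI)
  fix U :: "real set" assume "open U"
  then have "{\<omega> \<in> configurations. pairing f \<omega> \<in> U} \<in> {{\<omega> \<in> configurations. pairing f \<omega> \<in> U} | f U.
        continuous_on UNIV f \<and> compactly_supported f \<and> open U}"
    using assms unfolding test_function_def by blast
  then have "openin vague_topology {\<omega> \<in> configurations. pairing f \<omega> \<in> U}"
    unfolding vague_topology_def by (rule topology_generated_by_Basis)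
  moreover have "pairing f -` U \<inter> space vague_borel = {\<omega> \<in> configurations. pairing f \<omega> \<in> U}"
    by (auto simp: space_vague_borel)
  ultimately show "pairing f -` U \<inter> space vague_borel \<in> sets vague_borel"
    by (simp add: sets_vague_borel)
qed

text \<open>Only nonnegative test functions are used, so that \<open>exp (- pairing f \<omega>)\<close> lies in the unit
interval, where laws are determined by their moments.\<close>

definition pairing_cylinders :: "'a::metric_space set set set" where
  "pairing_cylinders = {{\<omega> \<in> configurations. pairing f \<omega> \<in> U} | f U.
      test_function f \<and> (\<forall>x. 0 \<le> f x) \<and> open U}"

lemma pairing_measurable_cylinders:
  assumes "test_function f" "\<And>x. 0 \<le> f x"
  shows "pairing f \<in> borel_measurable (sigma configurations pairing_cylinders)"
proof (rule borel_measurableI)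
  have sub: "pairing_cylinders \<subseteq> Pow (configurations :: 'a set set)"
    by (auto simp: pairing_cylinders_def)
  fix U :: "real set" assume "open U"
  then have "{\<omega> \<in> configurations. pairing f \<omega> \<in> U} \<in> pairing_cylinders"
    using assms unfolding pairing_cylinders_def by blast
  moreover have "pairing f -` U \<inter> configurations = {\<omega> \<in> configurations. pairing f \<omega> \<in> U}"
    by auto
  ultimately show "pairing f -` U \<inter> space (sigma configurations pairing_cylinders)
      \<in> sets (sigma configurations pairing_cylinders)"
    using sub by (auto simp: space_measure_of sets_measure_of)
qed

lemma pairing_sum:
  assumes "\<And>b. b \<in> F \<Longrightarrow> test_function (g b)" "\<omega> \<in> configurations"
  shows "pairing (\<lambda>x. \<Sum>b\<in>F. a b * g b x) \<omega> = (\<Sum>b\<in>F. a b * pairing (g b) \<omega>)"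
proof -
  have "pairing (\<lambda>x. \<Sum>b\<in>F. a b * g b x) \<omega> = (\<Sum>b\<in>F. pairing (\<lambda>x. a b * g b x) \<omega>)"
    using assms by (intro Bochner_Integration.integral_sum integrable_mult_right pairing_integrable) auto
  then show ?thesis
    by simp
qed

lemma pairing_bump_part_error:
  fixes F :: "('a::metric_space \<times> real) set"
  assumes B: "ball_basis B" and F: "F \<subseteq> B" and f: "test_function f"
    and \<omega>: "\<omega> \<in> configurations"
    and le: "\<And>x. \<bar>f x - (\<Sum>b\<in>F. a b * bump_part F k b x)\<bar> \<le> \<epsilon> * (\<Sum>b\<in>F. bump_part F k b x)"
  shows "\<bar>pairing f \<omega> - (\<Sum>b\<in>F. a b * pairing (bump_part F k b) \<omega>)\<bar>
    \<le> \<epsilon> * (\<Sum>b\<in>F. pairing (bump_part F k b) \<omega>)"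
proof -
  have tf: "test_function (bump_part F k b)" if "b \<in> F" for b
    using that F by (intro test_function_bump_part[OF B]) auto
  have int: "integrable (dirac_sum \<omega>) (\<lambda>x. \<Sum>b\<in>F. c b * bump_part F k b x)" for c
    by (intro Bochner_Integration.integrable_sum integrable_mult_right pairing_integrable tf \<omega>)
  have int1: "integrable (dirac_sum \<omega>) (\<lambda>x. \<epsilon> * (\<Sum>b\<in>F. bump_part F k b x))"
    using int[of "\<lambda>_. 1"] by simp
  have "\<bar>pairing f \<omega> - (\<Sum>b\<in>F. a b * pairing (bump_part F k b) \<omega>)\<bar> =
      \<bar>pairing (\<lambda>x. f x - (\<Sum>b\<in>F. a b * bump_part F k b x)) \<omega>\<bar>"
    using pairing_integrable[OF f \<omega>] int pairing_sum[of F "bump_part F k" \<omega> a] tf \<omega>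
    by (subst Bochner_Integration.integral_diff) auto
  also have "\<dots> \<le> pairing (\<lambda>x. \<bar>f x - (\<Sum>b\<in>F. a b * bump_part F k b x)\<bar>) \<omega>"
    by (rule integral_abs_bound)
  also have "\<dots> \<le> pairing (\<lambda>x. \<epsilon> * (\<Sum>b\<in>F. bump_part F k b x)) \<omega>"
    using le by (intro integral_mono integrable_abs Bochner_Integration.integrable_diff
        pairing_integrable[OF f \<omega>] int int1) auto
  also have "\<dots> = \<epsilon> * (\<Sum>b\<in>F. pairing (bump_part F k b) \<omega>)"
    using pairing_sum[of F "bump_part F k" \<omega> "\<lambda>_. 1"] tf \<omega> by simp
  finally show ?thesis .
qed

text \<open>The vague topology has uncountably many subbasic sets, and an arbitrary union of them is not
obviously in the \<open>\<sigma>\<close>-algebra that they generate. This is overcome by pulling back all of them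
along a single map into real sequences, built from the countably many functions \<open>\<psi>\<^sub>j\<close>. Around \<open>\<omega>\<^sub>0\<close> the
open set asks for two things: a linear combination of coordinates that approximates \<open>pairing f\<close> is close
to its value at \<open>\<omega>\<^sub>0\<close>, and the sum of coordinates that bounds the error stays below \<open>M\<close>.\<close>

lemma vague_basis_coordinates:
  fixes \<psi> :: "nat \<Rightarrow> 'a::metric_space \<Rightarrow> real"
  assumes sc: "sigma_compact (UNIV :: 'a set)"
    and lc: "locally compact (UNIV :: 'a set)"
    and B: "ball_basis (B :: ('a \<times> real) set)"
    and \<psi>: "range \<psi> = {bump_part F k b | F k b. finite F \<and> F \<subseteq> B \<and> b \<in> B}"
    and f: "test_function f" and U: "open U"
  shows "\<exists>V. open V \<and> {\<omega> \<in> configurations. pairing f \<omega> \<in> U} =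
    {\<omega> \<in> configurations. (\<lambda>j. pairing (\<psi> j) \<omega>) \<in> V}"
proof -
  let ?e = "\<lambda>\<omega> j. pairing (\<psi> j) \<omega>"
  have "\<exists>W. open W \<and> ?e \<omega>\<^sub>0 \<in> W \<and> (\<forall>\<omega>\<in>configurations. ?e \<omega> \<in> W \<longrightarrow> pairing f \<omega> \<in> U)"
    if \<omega>\<^sub>0: "\<omega>\<^sub>0 \<in> configurations" "pairing f \<omega>\<^sub>0 \<in> U" for \<omega>\<^sub>0
  proof -
    from bump_part_approximation[OF sc lc B f] obtain K where K: "compact K"
      and ap: "\<forall>\<epsilon>>0. \<exists>F k a. finite F \<and> F \<subseteq> B \<and>
           (\<forall>x. (\<Sum>b\<in>F. bump_part F k b x) \<le> indicator K x) \<and>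
           (\<forall>x. \<bar>f x - (\<Sum>b\<in>F. a b * bump_part F k b x)\<bar> \<le> \<epsilon> * (\<Sum>b\<in>F. bump_part F k b x))"
      by (elim exE conjE)
    obtain \<eta> where \<eta>: "0 < \<eta>" "\<And>y. \<bar>y - pairing f \<omega>\<^sub>0\<bar> < \<eta> \<Longrightarrow> y \<in> U"
      using U \<omega>\<^sub>0(2) unfolding open_dist dist_real_def by blast
    \<comment> \<open>The parts sum up to at most \<open>1\<close> on \<open>K\<close> and to \<open>0\<close> elsewhere, so at \<open>\<omega>\<^sub>0\<close> their pairings sum up to less
       than \<open>M\<close>, whichever \<open>\<epsilon>\<close> is chosen. This allows \<open>\<epsilon> = \<eta> / (3 M)\<close>: three errors of size \<open>\<eta> / 3\<close>.\<close>
    define M where "M = measure (dirac_sum \<omega>\<^sub>0) K + 1"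
    have M: "0 < M"
      by (simp add: M_def add_nonneg_pos)
    have "0 < \<eta> / (3 * M)"
      using \<eta>(1) M by simp
    from ap[rule_format, OF this] obtain F k a where F: "finite F" "F \<subseteq> B"
      and S1: "\<forall>x. (\<Sum>b\<in>F. bump_part F k b x) \<le> indicator K x"
      and S2: "\<forall>x. \<bar>f x - (\<Sum>b\<in>F. a b * bump_part F k b x)\<bar> \<le> \<eta> / (3 * M) * (\<Sum>b\<in>F. bump_part F k b x)"
      by (elim exE conjE)
    have tf: "test_function (bump_part F k b)" if "b \<in> F" for b
      using that F by (intro test_function_bump_part[OF B]) auto
    have "\<forall>b\<in>F. \<exists>j. \<psi> j = bump_part F k b"
    proof
      fix b assume "b \<in> F"
      then have "bump_part F k b \<in> range \<psi>"
        unfolding \<psi> using F by blast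
      then show "\<exists>j. \<psi> j = bump_part F k b"
        by (metis imageE)
    qed
    then obtain ix where ix: "\<And>b. b \<in> F \<Longrightarrow> \<psi> (ix b) = bump_part F k b"
      by metis
    define L where "L y = (\<Sum>b\<in>F. a b * y (ix b))" for y :: "nat \<Rightarrow> real"
    define S where "S y = (\<Sum>b\<in>F. y (ix b))" for y :: "nat \<Rightarrow> real"
    define W where "W = {y. \<bar>L y - L (?e \<omega>\<^sub>0)\<bar> < \<eta> / 3} \<inter> {y. S y < M}"
    have "open W"
      unfolding W_def L_def S_def
      by (intro open_Int open_Collect_less continuous_intros continuous_on_product_coordinates)
    moreover have "?e \<omega>\<^sub>0 \<in> W"
    proof -
      have "S (?e \<omega>\<^sub>0) = (\<Sum>b\<in>F. 1 * pairing (bump_part F k b) \<omega>\<^sub>0)"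
        unfolding S_def by (intro sum.cong) (simp_all add: ix)
      also have "\<dots> = pairing (\<lambda>x. \<Sum>b\<in>F. 1 * bump_part F k b x) \<omega>\<^sub>0"
        using tf \<omega>\<^sub>0(1) by (intro pairing_sum[symmetric])
      also have "\<dots> \<le> integral\<^sup>L (dirac_sum \<omega>\<^sub>0) (indicator K)"
      proof (rule integral_mono)
        show "integrable (dirac_sum \<omega>\<^sub>0) (\<lambda>x. \<Sum>b\<in>F. 1 * bump_part F k b x)"
          by (intro Bochner_Integration.integrable_sum integrable_mult_right pairing_integrable tf \<omega>\<^sub>0(1))
        have "K \<in> sets borel"
          using K by (simp add: borel_closed compact_imp_closed)
        moreover have "finite (\<omega>\<^sub>0 \<inter> K)"
          using \<omega>\<^sub>0(1) K by (simp add: configurations_def)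
        ultimately show "integrable (dirac_sum \<omega>\<^sub>0) (indicat_real K)"
          by (intro integrable_real_indicator)
             (simp_all add: emeasure_dirac_sum of_nat_less_top, simp_all add: dirac_sum_def)
      qed (simp add: S1)
      also have "\<dots> < M"
        using K by (simp add: M_def dirac_sum_def borel_closed compact_imp_closed)
      finally have "S (?e \<omega>\<^sub>0) < M" .
      then show ?thesis
        using \<eta>(1) by (simp add: W_def)
    qed
    moreover have "pairing f \<omega> \<in> U" if \<omega>: "\<omega> \<in> configurations" and W: "?e \<omega> \<in> W" for \<omega>
    proof -
      have err: "\<bar>pairing f \<omega>' - L (?e \<omega>')\<bar> < \<eta> / 3"
        if "\<omega>' \<in> configurations" "?e \<omega>' \<in> W" for \<omega>'
      proof -
        have 1: "L (?e \<omega>') = (\<Sum>b\<in>F. a b * pairing (bump_part F k b) \<omega>')"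
          unfolding L_def by (intro sum.cong) (simp_all add: ix)
        have 2: "S (?e \<omega>') = (\<Sum>b\<in>F. pairing (bump_part F k b) \<omega>')"
          unfolding S_def by (intro sum.cong) (simp_all add: ix)
        have "\<bar>pairing f \<omega>' - L (?e \<omega>')\<bar> \<le> \<eta> / (3 * M) * S (?e \<omega>')"
          unfolding 1 2 by (rule pairing_bump_part_error[OF B F(2) f that(1) S2[rule_format]])
        also have "\<dots> < \<eta> / (3 * M) * M"
          using that(2) \<eta>(1) M by (intro mult_strict_left_mono) (auto simp: W_def)
        finally show ?thesis
          using M by simp
      qed
      have "\<bar>L (?e \<omega>) - L (?e \<omega>\<^sub>0)\<bar> < \<eta> / 3"
        using W by (simp add: W_def)
      then have "\<bar>pairing f \<omega> - pairing f \<omega>\<^sub>0\<bar> < \<eta>"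
        using err[OF \<omega> W] err[OF \<omega>\<^sub>0(1) \<open>?e \<omega>\<^sub>0 \<in> W\<close>] by linarith
      then show ?thesis
        by (rule \<eta>(2))
    qed
    ultimately show ?thesis
      by blast
  qed
  then obtain W where W: "\<And>\<omega>\<^sub>0. \<omega>\<^sub>0 \<in> configurations \<Longrightarrow> pairing f \<omega>\<^sub>0 \<in> U \<Longrightarrow> open (W \<omega>\<^sub>0) \<and> ?e \<omega>\<^sub>0 \<in> W \<omega>\<^sub>0 \<and>
      (\<forall>\<omega>\<in>configurations. ?e \<omega> \<in> W \<omega>\<^sub>0 \<longrightarrow> pairing f \<omega> \<in> U)"
    by metis
  show ?thesis
    using W by (intro exI[of _ "\<Union>\<omega>\<^sub>0\<in>{\<omega> \<in> configurations. pairing f \<omega> \<in> U}. W \<omega>\<^sub>0"]) blast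
qed

text \<open>Sets of the form \<open>e -` V\<close> with \<open>V\<close> open and \<open>e\<close> a fixed map are closed under arbitrary unions and finite
intersections, so all vaguely open sets have this form. They are measurable because \<open>e\<close> is measurable
coordinatewise, real sequences being second countable.\<close>

lemma sets_vague_borel_eq_cylinders:
  assumes sc: "sigma_compact (UNIV :: 'a::metric_space set)"
    and lc: "locally compact (UNIV :: 'a set)"
  shows "sets (vague_borel :: 'a set measure) = sigma_sets configurations pairing_cylinders"
proof
  let ?N = "sigma configurations pairing_cylinders :: 'a set measure"
  have sub: "pairing_cylinders \<subseteq> Pow (configurations :: 'a set set)"
    by (auto simp: pairing_cylinders_def)
  show "sigma_sets configurations pairing_cylinders \<subseteq> sets (vague_borel :: 'a set measure)"
  proof -
    have "C \<in> sets vague_borel" if C: "C \<in> (pairing_cylinders :: 'a set set set)" for C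
    proof -
      obtain f :: "'a \<Rightarrow> real" and U where f: "test_function f" "open U"
        and eq: "C = {\<omega> \<in> configurations. pairing f \<omega> \<in> U}"
        using C unfolding pairing_cylinders_def by blast
      have "pairing f -` U \<inter> space vague_borel \<in> sets vague_borel"
        by (rule measurable_sets[OF pairing_measurable[OF f(1)]]) (simp add: f(2))
      moreover have "pairing f -` U \<inter> space vague_borel = C"
        by (auto simp: eq space_vague_borel)
      ultimately show ?thesis by simp
    qed
    then show ?thesis
      using sets.sigma_sets_subset[of pairing_cylinders "vague_borel :: 'a set measure"]
      by (auto simp: space_vague_borel)
  qed
  obtain B where B: "ball_basis (B :: ('a \<times> real) set)"
    by (rule ball_basis_exists[OF sc lc])
  let ?\<Psi> = "{bump_part F k b | F k b. finite F \<and> F \<subseteq> B \<and> b \<in> B}"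
  have "countable B" "B \<noteq> {}"
    using B unfolding ball_basis_def by (simp, fastforce intro: zero_less_one)
  have eq: "?\<Psi> = (\<lambda>(F, k, b). bump_part F k b) ` ({F. finite F \<and> F \<subseteq> B} \<times> UNIV \<times> B)"
    by force
  have "countable ({F. finite F \<and> F \<subseteq> B} \<times> (UNIV :: nat set) \<times> B)"
    using \<open>countable B\<close> by (intro countable_SIGMA countable_Collect_finite_subset) auto
  then have cnt: "countable ?\<Psi>"
    unfolding eq by (rule countable_image)
  have "?\<Psi> \<noteq> {}"
    using \<open>B \<noteq> {}\<close> by blast
  then have \<psi>: "range (from_nat_into ?\<Psi>) = ?\<Psi>"
    by (rule range_from_nat_into[OF _ cnt])
  define e where "e \<omega> = (\<lambda>j. pairing (from_nat_into ?\<Psi> j) \<omega>)" for \<omega>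
  have e: "e \<in> borel_measurable ?N"
    unfolding e_def[abs_def]
  proof (rule measurable_coordinatewise_then_product)
    fix j
    have "from_nat_into ?\<Psi> j \<in> ?\<Psi>"
      using \<psi> by blast
    then obtain F k b where b: "from_nat_into ?\<Psi> j = bump_part F k b" "b \<in> B"
      by blast
    show "(\<lambda>\<omega>. pairing (from_nat_into ?\<Psi> j) \<omega>) \<in> borel_measurable ?N"
      unfolding b(1)
      by (intro pairing_measurable_cylinders test_function_bump_part[OF B b(2)] bump_part_nonneg)
  qed
  have "\<exists>V. open V \<and> U = {\<omega> \<in> configurations. e \<omega> \<in> V}"
    if "generate_topology_on {{\<omega> \<in> configurations. pairing f \<omega> \<in> U} | (f :: 'a \<Rightarrow> real) U.
        continuous_on UNIV f \<and> compactly_supported f \<and> open U} U" for U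
    using that
  proof induction
    case Empty
    show ?case by (intro exI[of _ "{}"]) simp
  next
    case (Int a b)
    then obtain V W where VW: "open V" "a = {\<omega> \<in> configurations. e \<omega> \<in> V}"
        "open W" "b = {\<omega> \<in> configurations. e \<omega> \<in> W}"
      by blast
    have "a \<inter> b = {\<omega> \<in> configurations. e \<omega> \<in> V \<inter> W}"
      unfolding VW(2,4) by blast
    then show ?case
      using open_Int[OF VW(1,3)] by blast
  next
    case (UN K)
    then obtain V where V: "\<And>k. k \<in> K \<Longrightarrow> open (V k)" "\<And>k. k \<in> K \<Longrightarrow> k = {\<omega> \<in> configurations. e \<omega> \<in> V k}"
      by metis
    show ?case
    proof (intro exI[of _ "\<Union>k\<in>K. V k"] conjI)
      show "open (\<Union>k\<in>K. V k)"
        using V(1) by blast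
      show "\<Union>K = {\<omega> \<in> configurations. e \<omega> \<in> (\<Union>k\<in>K. V k)}"
        using V(2) by blast
    qed
  next
    case (Basis s)
    then obtain f U where fU: "s = {\<omega> \<in> configurations. pairing f \<omega> \<in> U}" "test_function f" "open U"
      unfolding test_function_def by blast
    show ?case
      unfolding fU(1) e_def by (rule vague_basis_coordinates[OF sc lc B \<psi> fU(2,3)])
  qed
  then have "U \<in> sets ?N" if U: "openin vague_topology U" for U :: "'a set set"
  proof -
    obtain V where V: "open V" "U = {\<omega> \<in> configurations. e \<omega> \<in> V}"
      using U \<open>\<And>U. generate_topology_on _ U \<Longrightarrow> _\<close>
      unfolding vague_topology_def openin_topology_generated_by_iff by blast
    have "e -` V \<inter> space ?N \<in> sets ?N"
      by (rule measurable_sets[OF e]) (simp add: V(1))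
    moreover have "e -` V \<inter> space ?N = U"
      using sub by (auto simp: V(2) space_measure_of)
    ultimately show ?thesis by simp
  qed
  then have "sigma_sets (space ?N) {U. openin vague_topology U} \<subseteq> sets ?N"
    by (intro sets.sigma_sets_subset) auto
  then show "sets (vague_borel :: 'a set measure) \<subseteq> sigma_sets configurations pairing_cylinders"
    using sub by (simp add: sets_vague_borel space_measure_of sets_measure_of)
qed

section \<open>Adding a point is measurable\<close>

text \<open>The diagonal of the space need not be measurable for a product \<open>\<sigma>\<close>-algebra in general; this countable
description makes the event \<open>x \<in> \<omega>\<close> jointly measurable. The converse direction uses that a
configuration is locally finite, hence closed.\<close>

lemma membership_via_balls:
  assumes sc: "sigma_compact (UNIV :: 'a::metric_space set)"
    and lc: "locally compact (UNIV :: 'a set)"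
    and B: "ball_basis (B :: ('a \<times> real) set)" and \<omega>: "\<omega> \<in> configurations"
  shows "x \<in> \<omega> \<longleftrightarrow> (\<forall>m::nat. \<exists>b\<in>{b\<in>B. snd b < 1 / Suc m}. x \<in> ball (fst b) (snd b) \<and> 0 < pairing (bump b) \<omega>)"
    (is "_ \<longleftrightarrow> ?R")
proof -
  have pos: "0 < pairing (bump b) \<omega> \<longleftrightarrow> (\<exists>y\<in>\<omega>. dist y (fst b) < snd b)" if "b \<in> B" for b
    using pairing_pos_iff[OF test_function_bump[OF B that] \<omega> bump_nonneg] by (simp add: bump_pos_iff)
  show ?thesis
  proof
    assume x: "x \<in> \<omega>"
    show ?R
    proof
      fix m :: nat
      obtain c r where "(c, r) \<in> B" "dist x c < r" "r < 1 / Suc m"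
        using B unfolding ball_basis_def by (metis (no_types, lifting) case_prodE of_nat_0_less_iff zero_less_Suc zero_less_divide_1_iff)
      then show "\<exists>b\<in>{b\<in>B. snd b < 1 / Suc m}. x \<in> ball (fst b) (snd b) \<and> 0 < pairing (bump b) \<omega>"
        using x pos[of "(c, r)"] by (intro bexI[of _ "(c, r)"]) (auto simp: dist_commute)
    qed
  next
    assume R: ?R
    obtain r where r: "0 < r" "compact (cball x r)"
      by (rule compact_cball_exists[OF sc lc])
    have fin: "finite (\<omega> \<inter> cball x r)"
      using \<omega> r(2) by (simp add: configurations_def)
    have near: "\<exists>y\<in>\<omega>. dist x y < e" if e: "0 < e" for e
    proof -
      obtain m where m: "1 / real (Suc m) < e / 2"
        using e by (metis half_gt_zero nat_approx_posE)
      obtain b where b: "b \<in> B" "snd b < 1 / Suc m" "x \<in> ball (fst b) (snd b)" "0 < pairing (bump b) \<omega>"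
        using R by blast
      then obtain y where "y \<in> \<omega>" "dist y (fst b) < snd b"
        using pos by blast
      then show ?thesis
        using b(2,3) m dist_triangle[of x y "fst b"] by (intro bexI[of _ y]) (auto simp: dist_commute)
    qed
    show "x \<in> \<omega>"
    proof (rule ccontr)
      assume x: "x \<notin> \<omega>"
      define e where "e = Min (insert r (dist x ` (\<omega> \<inter> cball x r)))"
      have "0 < e"
        unfolding e_def using fin r(1) x by (subst Min_gr_iff) auto
      then obtain y where y: "y \<in> \<omega>" "dist x y < e"
        using near by blast
      have "e \<le> r"
        unfolding e_def using fin by (intro Min_le) auto
      moreover have "e \<le> dist x y" if "y \<in> cball x r"
        unfolding e_def using fin that y(1) by (intro Min_le) auto
      ultimately show False
        using y(2) by fastforce
    qed
  qed
qed

lemma insert_measurable: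
  assumes sc: "sigma_compact (UNIV :: 'a::metric_space set)"
    and lc: "locally compact (UNIV :: 'a set)"
  shows "(\<lambda>(x::'a, \<omega>). insert x \<omega>) \<in> borel \<Otimes>\<^sub>M vague_borel \<rightarrow>\<^sub>M vague_borel"
proof -
  let ?P = "borel \<Otimes>\<^sub>M vague_borel :: ('a \<times> 'a set) measure"
  have spP: "space ?P = UNIV \<times> configurations"
    by (simp add: space_pair_measure space_vague_borel)
  obtain B where B: "ball_basis (B :: ('a \<times> real) set)"
    by (rule ball_basis_exists[OF sc lc])
  have cnt: "countable {b\<in>B. snd b < e}" for e
    using B by (auto simp: ball_basis_def)
  have mem: "{p \<in> space ?P. fst p \<in> snd p} \<in> sets ?P"
  proof -
    have "{p \<in> space ?P. fst p \<in> snd p} = {p \<in> space ?P. \<forall>m::nat. \<exists>b\<in>{b\<in>B. snd b < 1 / Suc m}.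
        fst p \<in> ball (fst b) (snd b) \<and> 0 < pairing (bump b) (snd p)}"
      using membership_via_balls[OF sc lc B] by (auto simp: spP)
    also have "\<dots> \<in> sets ?P"
    proof (intro sets.sets_Collect_countable_All sets.sets_Collect_countable_Ex'[OF _ cnt] sets.sets_Collect_conj)
      fix m :: nat and b assume "b \<in> {b\<in>B. snd b < 1 / Suc m}"
      then have "test_function (bump b)"
        using test_function_bump[OF B] by auto
      then have "(\<lambda>p. pairing (bump b) (snd p)) \<in> borel_measurable ?P"
        by (intro measurable_compose[OF measurable_snd pairing_measurable])
      then show "{p \<in> space ?P. 0 < pairing (bump b) (snd p)} \<in> sets ?P"
        by measurable
      show "{p \<in> space ?P. fst p \<in> ball (fst b) (snd b)} \<in> sets ?P"
        using measurable_sets[OF measurable_fst, of "ball (fst b) (snd b)" borel "vague_borel :: 'a set measure"]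
        by (simp add: vimage_def Int_def conj_commute)
    qed
    finally show ?thesis .
  qed
  show ?thesis
  proof (rule measurable_sigma_sets[OF sets_vague_borel_eq_cylinders[OF sc lc]])
    show "pairing_cylinders \<subseteq> Pow configurations"
      by (auto simp: pairing_cylinders_def)
    show "(\<lambda>(x::'a, \<omega>). insert x \<omega>) \<in> space ?P \<rightarrow> configurations"
      by (auto simp: spP insert_configuration)
    fix C :: "'a set set" assume "C \<in> pairing_cylinders"
    then obtain f U where f: "test_function f" "open U" and eq: "C = {\<omega> \<in> configurations. pairing f \<omega> \<in> U}"
      unfolding pairing_cylinders_def by blast
    let ?g = "\<lambda>p. pairing f (snd p) + (if fst p \<in> snd p then 0 else f (fst p))"
    have "?g \<in> borel_measurable ?P"
      by (intro borel_measurable_add measurable_compose[OF measurable_snd pairing_measurable[OF f(1)]]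
           measurable_If measurable_compose[OF measurable_fst test_function_borel[OF f(1)]] mem) simp
    then have "?g -` U \<inter> space ?P \<in> sets ?P"
      by (rule measurable_sets) (simp add: f(2))
    moreover have "(\<lambda>(x::'a, \<omega>). insert x \<omega>) -` C \<inter> space ?P = ?g -` U \<inter> space ?P"
      by (auto simp: eq spP pairing_insert[OF f(1)] insert_configuration split: if_splits)
    ultimately show "(\<lambda>(x::'a, \<omega>). insert x \<omega>) -` C \<inter> space ?P \<in> sets ?P"
      by simp
  qed
qed

text \<open>A configuration is empty iff each of the countably many bumps has pairing \<open>0\<close> with it.\<close>

lemma empty_configuration_measurable:
  assumes sc: "sigma_compact (UNIV :: 'a::metric_space set)"
    and lc: "locally compact (UNIV :: 'a set)"
  shows "{{}} \<in> sets (vague_borel :: 'a set measure)"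
proof -
  obtain B where B: "ball_basis (B :: ('a \<times> real) set)"
    by (rule ball_basis_exists[OF sc lc])
  have tf: "test_function (bump b)" if "b \<in> B" for b
    using test_function_bump[OF B that] .
  have "{\<omega> \<in> space vague_borel. \<forall>b\<in>B. \<not> 0 < pairing (bump b) \<omega>} \<in> sets vague_borel"
  proof (rule sets.sets_Collect_countable_All')
    show "countable B"
      using B by (simp add: ball_basis_def)
    show "{\<omega> \<in> space vague_borel. \<not> 0 < pairing (bump b) \<omega>} \<in> sets vague_borel" if "b \<in> B" for b
      using pairing_measurable[OF tf[OF that]] by measurable
  qed
  also have "{\<omega> \<in> space vague_borel. \<forall>b\<in>B. \<not> 0 < pairing (bump b) \<omega>} = {{}}"
  proof -
    have "\<exists>b\<in>B. 0 < pairing (bump b) \<omega>" if \<omega>: "\<omega> \<in> configurations" and x: "x \<in> \<omega>" for \<omega> x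
      using iffD1[OF membership_via_balls[OF sc lc B \<omega>] x] by blast
    moreover have "\<not> 0 < pairing (bump b) {}" if "b \<in> B" for b
      using pairing_pos_iff[OF tf[OF that] empty_configuration bump_nonneg] by simp
    ultimately show ?thesis
      by (fastforce simp: space_vague_borel empty_configuration)
  qed
  finally show ?thesis .
qed

section \<open>The Laplace functional determines the law\<close>

lemma integral_diff_le_const:
  fixes f g :: "'b \<Rightarrow> real"
  assumes "finite_measure M" "integrable M f" "integrable M g" "AE x in M. \<bar>f x - g x\<bar> \<le> e"
  shows "\<bar>integral\<^sup>L M f - integral\<^sup>L M g\<bar> \<le> e * measure M (space M)"
proof -
  interpret finite_measure M by fact
  have "\<bar>integral\<^sup>L M f - integral\<^sup>L M g\<bar> = \<bar>\<integral>x. f x - g x \<partial>M\<bar>"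
    using assms(2,3) by simp
  also have "\<dots> \<le> (\<integral>x. \<bar>f x - g x\<bar> \<partial>M)"
    by (rule integral_abs_bound)
  also have "\<dots> \<le> (\<integral>x. e \<partial>M)"
    using assms by (intro integral_mono_AE) auto
  finally show ?thesis
    by (simp add: mult.commute)
qed

text \<open>By the Weierstrass approximation theorem on the unit interval.\<close>

lemma equal_moments_imp_equal_continuous_integrals:
  fixes P Q :: "real measure"
  assumes P: "finite_measure P" "sets P = sets borel" "AE y in P. y \<in> {0..1}"
    and Q: "finite_measure Q" "sets Q = sets borel" "AE y in Q. y \<in> {0..1}"
    and moments: "\<And>m::nat. (\<integral>y. y ^ m \<partial>P) = (\<integral>y. y ^ m \<partial>Q)"
    and g: "continuous_on UNIV g"
  shows "(\<integral>y. g y \<partial>P) = (\<integral>y. g y \<partial>Q :: real)"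
proof -
  have int: "integrable R h" if h: "continuous_on UNIV h"
    and R: "finite_measure R" "sets R = sets borel" "AE y in R. y \<in> {0..1}" for R :: "real measure" and h :: "real \<Rightarrow> real"
  proof -
    obtain c where c: "\<And>y. y \<in> {0..1} \<Longrightarrow> norm (h y) \<le> c"
      using compact_imp_bounded[OF compact_continuous_image[OF continuous_on_subset[OF h subset_UNIV] compact_Icc[of 0 1]]]
      unfolding bounded_iff by blast
    have "AE y in R. norm (h y) \<le> c"
      using R(3) by (rule eventually_mono) (rule c)
    moreover have "h \<in> borel_measurable R"
      using borel_measurable_continuous_onI[OF h] by (simp add: measurable_cong_sets[OF R(2) refl])
    ultimately show ?thesis
      by (rule finite_measure.integrable_const_bound[OF R(1)])
  qed
  define m where "m = measure P (space P) + measure Q (space Q)"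
  have "\<bar>(\<integral>y. g y \<partial>P) - (\<integral>y. g y \<partial>Q)\<bar> \<le> e * m" if e: "0 < e" for e
  proof -
    obtain p where p: "real_polynomial_function p" "\<And>y. y \<in> {0..1} \<Longrightarrow> \<bar>g y - p y\<bar> < e"
      using Stone_Weierstrass_real_polynomial_function[OF compact_Icc continuous_on_subset[OF g subset_UNIV] e] by metis
    obtain a n where a: "p = (\<lambda>y. \<Sum>i\<le>n. a i * y ^ i)"
      using p(1) unfolding real_polynomial_function_iff_sum by blast
    have pc: "continuous_on UNIV p"
      unfolding a by (intro continuous_intros)
    have pw: "integrable P (\<lambda>y. y ^ i)" "integrable Q (\<lambda>y. y ^ i)" for i :: nat
      by (intro int P Q continuous_intros)+
    have near: "AE y in R. \<bar>g y - p y\<bar> \<le> e" if "AE y in R. y \<in> {0..1}" for R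
      using that by (rule eventually_mono) (rule less_imp_le[OF p(2)])
    have "(\<integral>y. p y \<partial>P) = (\<integral>y. p y \<partial>Q)"
      unfolding a using pw by (simp add: moments)
    moreover have "\<bar>(\<integral>y. g y \<partial>P) - (\<integral>y. p y \<partial>P)\<bar> \<le> e * measure P (space P)"
      by (intro integral_diff_le_const near P int g pc)
    moreover have "\<bar>(\<integral>y. g y \<partial>Q) - (\<integral>y. p y \<partial>Q)\<bar> \<le> e * measure Q (space Q)"
      by (intro integral_diff_le_const near Q int g pc)
    ultimately show ?thesis
      by (simp add: m_def distrib_left)
  qed
  then have "\<bar>(\<integral>y. g y \<partial>P) - (\<integral>y. g y \<partial>Q)\<bar> \<le> 0 + e" if "0 < e" for e
  proof -
    have m: "0 \<le> m" by (simp add: m_def)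
    have "\<bar>(\<integral>y. g y \<partial>P) - (\<integral>y. g y \<partial>Q)\<bar> \<le> e / (m + 1) * m"
      using \<open>\<And>e. 0 < e \<Longrightarrow> _ \<le> e * m\<close>[of "e / (m + 1)"] that m by simp
    also have "\<dots> \<le> e"
      using that m by (simp add: field_simps)
    finally show ?thesis by simp
  qed
  then have "\<bar>(\<integral>y. g y \<partial>P) - (\<integral>y. g y \<partial>Q)\<bar> \<le> 0"
    by (rule field_le_epsilon)
  then show ?thesis
    by simp
qed

lemma equal_moments_imp_equal:
  fixes P Q :: "real measure"
  assumes P: "finite_measure P" "sets P = sets borel" "AE y in P. y \<in> {0..1}"
    and Q: "finite_measure Q" "sets Q = sets borel" "AE y in Q. y \<in> {0..1}"
    and moments: "\<And>m::nat. (\<integral>y. y ^ m \<partial>P) = (\<integral>y. y ^ m \<partial>Q)"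
  shows "P = Q"
proof -
  \<comment> \<open>Piecewise linear functions that equal \<open>1\<close> up to \<open>a\<close> and decrease to \<open>0\<close> within distance \<open>1 / n\<close>; they
     converge to the indicator of \<open>{..a}\<close>.\<close>
  define g where "g a n y = max 0 (min 1 (1 - real n * (y - a)))" for a y :: real and n
  have gc: "continuous_on UNIV (g a n)" for a n
    unfolding g_def by (intro continuous_intros)
  have lim: "(\<lambda>n. g a n y) \<longlonglongrightarrow> indicator {..a} y" for a y
  proof (cases "y \<le> a")
    case True
    then have "g a n y = 1" for n
      by (auto simp: g_def max_def min_def mult_nonneg_nonpos)
    then show ?thesis using True by simp
  next
    case False
    obtain N where N: "1 / (y - a) < real N"
      using reals_Archimedean2 by blast
    have "g a n y = 0" if "N \<le> n" for n
    proof -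
      have "1 < real N * (y - a)"
        using N False by (simp add: field_simps)
      also have "\<dots> \<le> real n * (y - a)"
        using that False by (intro mult_right_mono) auto
      finally show ?thesis by (simp add: g_def)
    qed
    then have "eventually (\<lambda>n. g a n y = indicator {..a} y) sequentially"
      using False by (auto simp: eventually_sequentially)
    then show ?thesis by (rule tendsto_eventually)
  qed
  have conv: "(\<lambda>n. \<integral>y. g a n y \<partial>R) \<longlonglongrightarrow> measure R {..a}" if R: "finite_measure R" "sets R = sets borel" for R a
  proof -
    interpret finite_measure R by fact
    have "(\<lambda>n. \<integral>y. g a n y \<partial>R) \<longlonglongrightarrow> (\<integral>y. indicator {..a} y \<partial>R)"
    proof (rule integral_dominated_convergence[where w = "\<lambda>_. 1"])
      show "g a n \<in> borel_measurable R" for n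
        using borel_measurable_continuous_onI[OF gc] by (simp add: measurable_cong_sets[OF R(2) refl])
      show "indicat_real {..a} \<in> borel_measurable R"
        using R(2) by (simp add: borel_measurable_indicator)
      show "AE y in R. (\<lambda>n. g a n y) \<longlonglongrightarrow> indicat_real {..a} y"
        by (simp add: lim)
      show "AE y in R. norm (g a n y) \<le> 1" for n
        by (simp add: g_def)
    qed simp
    moreover have "{..a} \<inter> space R = {..a}"
      using sets_eq_imp_space_eq[OF R(2)] by simp
    ultimately show ?thesis
      by simp
  qed
  have eq: "measure P {..a} = measure Q {..a}" for a
    using conv[OF P(1,2), of a] conv[OF Q(1,2), of a]
    unfolding equal_moments_imp_equal_continuous_integrals[OF P Q moments gc] by (rule LIMSEQ_unique)
  interpret P: finite_measure P by fact
  interpret Q: finite_measure Q by fact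
  show ?thesis
  proof (rule measure_eqI_generator_eq)
    show "Int_stable (range (atMost :: real \<Rightarrow> _))"
      by (auto simp: Int_stable_def)
    show "range (atMost :: real \<Rightarrow> _) \<subseteq> Pow UNIV" "range (\<lambda>n::nat. {..real n}) \<subseteq> range atMost"
      by auto
    show "sets P = sigma_sets UNIV (range atMost)" "sets Q = sigma_sets UNIV (range atMost)"
      using P(2) Q(2) by (simp_all add: borel_eq_atMost)
    show "(\<Union>n::nat. {..real n}) = UNIV"
      by (auto intro: real_arch_simple)
    show "emeasure P {..real n} \<noteq> \<infinity>" for n
      by simp
    show "emeasure P X = emeasure Q X" if "X \<in> range atMost" for X
      using that by (auto simp: P.emeasure_eq_measure Q.emeasure_eq_measure eq)
  qed
qed

text \<open>The moment theorem for the image under \<open>Y\<close> of the measures with density \<open>W\<close>. The weight carries the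
other coordinates when a joint law is determined one coordinate at a time.\<close>

lemma weighted_moments_determine:
  fixes Y W :: "'b \<Rightarrow> real"
  assumes P: "finite_measure P" and Q: "finite_measure Q" and sets: "sets Q = sets P"
    and Y: "Y \<in> borel_measurable P" and W: "W \<in> borel_measurable P"
    and Y01: "\<And>x. x \<in> space P \<Longrightarrow> Y x \<in> {0..1}" and W01: "\<And>x. x \<in> space P \<Longrightarrow> W x \<in> {0..1}"
    and moments: "\<And>m::nat. (\<integral>x. W x * Y x ^ m \<partial>P) = (\<integral>x. W x * Y x ^ m \<partial>Q)"
    and A: "A \<in> sets borel"
  shows "(\<integral>x. W x * indicator A (Y x) \<partial>P) = (\<integral>x. W x * indicator A (Y x) \<partial>Q)"
proof -
  define D where "D R = distr (density R W) borel Y" for R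
  have D: "finite_measure (D R)" "AE y in D R. y \<in> {0..1}"
    "h \<in> borel_measurable borel \<Longrightarrow> (\<integral>y. h y \<partial>(D R)) = (\<integral>x. W x * h (Y x) \<partial>R)"
    if R: "finite_measure R" "sets R = sets P" for R and h :: "real \<Rightarrow> real"
  proof -
    have YR: "Y \<in> borel_measurable R" and WR: "W \<in> borel_measurable R"
      using Y W measurable_cong_sets[OF R(2) refl] by blast+
    have sp: "space R = space P"
      using R(2) by (rule sets_eq_imp_space_eq)
    have YD: "Y \<in> density R W \<rightarrow>\<^sub>M borel"
      using YR by simp
    interpret finite_measure R by fact
    have "emeasure (D R) (space (D R)) = (\<integral>\<^sup>+x. W x \<partial>R)"
      using WR emeasure_distr[OF YD, of UNIV]
      by (simp add: D_def emeasure_density cong: nn_integral_cong_simp)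
    also have "\<dots> \<le> (\<integral>\<^sup>+x. 1 \<partial>R)"
      using W01 by (intro nn_integral_mono) (simp add: sp)
    finally have "emeasure (D R) (space (D R)) \<le> emeasure R (space R)"
      by simp
    then show "finite_measure (D R)"
      by (intro finite_measureI) (metis emeasure_finite infinity_ennreal_def top.extremum_unique)
    show "AE y in D R. y \<in> {0..1}"
      unfolding D_def using Y01 by (subst AE_distr_iff[OF YD]) (auto simp: sp)
    show "(\<integral>y. h y \<partial>D R) = (\<integral>x. W x * h (Y x) \<partial>R)" if h: "h \<in> borel_measurable borel"
    proof -
      have "AE x in R. 0 \<le> W x"
        using W01 by (intro AE_I2) (simp add: sp)
      then have "(\<integral>x. h (Y x) \<partial>density R W) = (\<integral>x. W x *\<^sub>R h (Y x) \<partial>R)"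
        using measurable_compose[OF YR h] WR by (intro integral_density)
      then show ?thesis
        unfolding D_def using integral_distr[OF YD h] by simp
    qed
  qed
  have "D P = D Q"
  proof (rule equal_moments_imp_equal)
    show "(\<integral>y. y ^ m \<partial>D P) = (\<integral>y. y ^ m \<partial>D Q)" for m
      using D(3)[OF P refl, of "\<lambda>y. y ^ m"] D(3)[OF Q sets, of "\<lambda>y. y ^ m"] moments[of m] by simp
  qed (use D[OF P refl] D[OF Q sets] in \<open>simp_all add: D_def\<close>)
  then show ?thesis
    using D(3)[OF P refl, of "indicator A"] D(3)[OF Q sets, of "indicator A"] A by simp
qed


definition cylinder :: "(('a::metric_space \<Rightarrow> real) \<times> real set) list \<Rightarrow> 'a set set" where
  "cylinder xs = {\<omega> \<in> configurations. \<forall>(f, U)\<in>set xs. pairing f \<omega> \<in> U}"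

text \<open>The finite lists of constraints whose cylinders form the intersection-stable generator.\<close>

definition cylinder_base :: "(('a::metric_space \<Rightarrow> real) \<times> real set) list \<Rightarrow> bool" where
  "cylinder_base xs \<longleftrightarrow> (\<forall>(f, U)\<in>set xs. test_function f \<and> (\<forall>x. 0 \<le> f x) \<and> open U)"

lemma cylinder_measurable:
  "cylinder_base xs \<Longrightarrow> cylinder xs \<in> sets (vague_borel :: 'a::metric_space set measure)"
proof (induction xs)
  case Nil
  then show ?case
    using sets.top[of "vague_borel :: 'a set measure"] by (simp add: cylinder_def space_vague_borel)
next
  case (Cons p xs)
  obtain f U where p: "p = (f, U)" by (cases p)
  have "pairing f -` U \<inter> space vague_borel \<in> sets (vague_borel :: 'a set measure)"
    using Cons.prems by (intro measurable_sets[OF pairing_measurable]) (auto simp: cylinder_base_def p)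
  moreover have "cylinder (p # xs) = (pairing f -` U \<inter> space vague_borel) \<inter> cylinder xs"
    by (auto simp: cylinder_def p space_vague_borel)
  ultimately show ?case
    using Cons by (auto simp: cylinder_base_def)
qed

text \<open>Induction on the number of constraints; the remaining exponential is kept in the statement so that
the induction can proceed. To add the constraint \<open>pairing f \<omega> \<in> U\<close>, take the indicator of the cylinder times
\<open>exp (- pairing g \<omega>)\<close> as weight: multiplying it by the \<open>m\<close>-th power of \<open>exp (- pairing f \<omega>)\<close> only replaces \<open>g\<close> by
\<open>g + m f\<close>, so the induction hypothesis provides all weighted moments of \<open>exp (- pairing f \<omega>)\<close>.\<close>

lemma Laplace_functional_cylinder:
  fixes P Q :: "'a::metric_space set measure"
  assumes P: "prob_space P" "sets P = sets vague_borel"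
    and Q: "prob_space Q" "sets Q = sets vague_borel"
    and Laplace: "\<And>f. test_function f \<Longrightarrow> (\<And>x. 0 \<le> f x) \<Longrightarrow>
      (\<integral>\<omega>. exp (- pairing f \<omega>) \<partial>P) = (\<integral>\<omega>. exp (- pairing f \<omega>) \<partial>Q)"
    and xs: "cylinder_base xs" and g: "test_function g" "\<And>x. 0 \<le> g x"
  shows "(\<integral>\<omega>. indicator (cylinder xs) \<omega> * exp (- pairing g \<omega>) \<partial>P) =
    (\<integral>\<omega>. indicator (cylinder xs) \<omega> * exp (- pairing g \<omega>) \<partial>Q)"
  using xs g
proof (induction xs arbitrary: g)
  case Nil
  have sp: "space P = configurations" "space Q = configurations"
    using P(2) Q(2) sets_eq_imp_space_eq space_vague_borel by metis+
  have "(\<integral>\<omega>. indicator (cylinder []) \<omega> * exp (- pairing g \<omega>) \<partial>R) = (\<integral>\<omega>. exp (- pairing g \<omega>) \<partial>R)"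
    if "space R = configurations" for R
    using that by (intro Bochner_Integration.integral_cong) (simp_all add: cylinder_def)
  then show ?case
    using sp Laplace[OF Nil(2,3)] by simp
next
  case (Cons p xs)
  obtain f U where p: "p = (f, U)" by (cases p)
  have f: "test_function f" "\<And>x. 0 \<le> f x" and U: "open U" and xs: "cylinder_base xs"
    using Cons.prems(1) by (auto simp: cylinder_base_def p)
  have sp: "space P = configurations" "space Q = configurations"
    using P(2) Q(2) sets_eq_imp_space_eq space_vague_borel by metis+
  interpret P: prob_space P by fact
  interpret Q: prob_space Q by fact
  define W where "W \<omega> = indicator (cylinder xs) \<omega> * exp (- pairing g \<omega>)" for \<omega>
  \<comment> \<open>The constraint \<open>pairing f \<omega> \<in> U\<close>, expressed through \<open>y = exp (- pairing f \<omega>)\<close>.\<close>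
  define A where "A = (\<lambda>y::real. - ln y) -` U"
  have A: "A \<in> sets borel"
    unfolding A_def using U measurable_sets[of "\<lambda>y::real. - ln y" borel borel U] by simp
  have pm: "pairing h \<in> borel_measurable P" if "test_function h" for h
    using pairing_measurable[OF that] measurable_cong_sets[OF P(2) refl] by blast
  have "(\<integral>\<omega>. W \<omega> * indicator A (exp (- pairing f \<omega>)) \<partial>P) = (\<integral>\<omega>. W \<omega> * indicator A (exp (- pairing f \<omega>)) \<partial>Q)"
  proof (rule weighted_moments_determine)
    show "finite_measure P" "finite_measure Q" "sets Q = sets P"
      using P(2) Q(2) by (simp_all add: P.finite_measure_axioms Q.finite_measure_axioms)
    show "(\<lambda>\<omega>. exp (- pairing f \<omega>)) \<in> borel_measurable P"
      using pm[OF f(1)] by simp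
    show "W \<in> borel_measurable P"
      unfolding W_def using pm[OF Cons.prems(2)] cylinder_measurable[OF xs] P(2) by simp
    show "exp (- pairing f \<omega>) \<in> {0..1}" for \<omega>
      using pairing_nonneg[of f \<omega>] f(2) by simp
    show "W \<omega> \<in> {0..1}" for \<omega>
      using pairing_nonneg[of g \<omega>] Cons.prems(3) by (simp add: W_def indicator_def)
    show "A \<in> sets borel" by fact
    show "(\<integral>\<omega>. W \<omega> * exp (- pairing f \<omega>) ^ m \<partial>P) = (\<integral>\<omega>. W \<omega> * exp (- pairing f \<omega>) ^ m \<partial>Q)" for m :: nat
    proof -
      let ?h = "\<lambda>x. g x + real m * f x"
      have h: "test_function ?h"
        by (intro test_function_add test_function_scale Cons.prems f)
      have eq: "(\<integral>\<omega>. W \<omega> * exp (- pairing f \<omega>) ^ m \<partial>R) = (\<integral>\<omega>. indicator (cylinder xs) \<omega> * exp (- pairing ?h \<omega>) \<partial>R)"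
        if "space R = configurations" for R
      proof (rule Bochner_Integration.integral_cong[OF refl])
        fix \<omega> assume "\<omega> \<in> space R"
        then have "pairing ?h \<omega> = pairing g \<omega> + real m * pairing f \<omega>"
          using that pairing_add[OF Cons.prems(2) test_function_scale[OF f(1)]] by simp
        then show "W \<omega> * exp (- pairing f \<omega>) ^ m = indicator (cylinder xs) \<omega> * exp (- pairing ?h \<omega>)"
          by (simp add: W_def exp_add exp_of_nat_mult[symmetric] flip: exp_add)
      qed
      show ?thesis
        unfolding eq[OF sp(1)] eq[OF sp(2)]
        using f(2) Cons.prems(3) by (intro Cons.IH xs h) simp
    qed
  qed
  moreover have "(\<integral>\<omega>. W \<omega> * indicator A (exp (- pairing f \<omega>)) \<partial>R) =
      (\<integral>\<omega>. indicator (cylinder (p # xs)) \<omega> * exp (- pairing g \<omega>) \<partial>R)" if "space R = configurations" for R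
    using that by (intro Bochner_Integration.integral_cong)
      (auto simp: W_def A_def cylinder_def p indicator_def)
  ultimately show ?case
    using sp by simp
qed

lemma Laplace_functional_unique:
  fixes P Q :: "'a::metric_space set measure"
  assumes sc: "sigma_compact (UNIV :: 'a set)"
    and lc: "locally compact (UNIV :: 'a set)"
    and P: "prob_space P" "sets P = sets vague_borel"
    and Q: "prob_space Q" "sets Q = sets vague_borel"
    and Laplace: "\<And>f. test_function f \<Longrightarrow> (\<And>x. 0 \<le> f x) \<Longrightarrow>
      (\<integral>\<omega>. exp (- pairing f \<omega>) \<partial>P) = (\<integral>\<omega>. exp (- pairing f \<omega>) \<partial>Q)"
  shows "P = Q"
proof -
  let ?E = "cylinder ` {xs. cylinder_base xs} :: 'a set set set"
  interpret P: prob_space P by fact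
  interpret Q: prob_space Q by fact
  have "test_function (\<lambda>_::'a. 0)"
    by (rule test_functionI[of _ "{}"]) auto
  then have eq: "measure P (cylinder xs) = measure Q (cylinder xs)" if "cylinder_base xs" for xs
    using Laplace_functional_cylinder[OF P Q Laplace that, of "\<lambda>_. 0"] cylinder_measurable[OF that] P(2) Q(2)
    by (simp add: sets.Int_space_eq2)
  have sets: "sigma_sets configurations ?E = sets vague_borel"
  proof
    have "?E \<subseteq> sets vague_borel"
      using cylinder_measurable by auto
    then show "sigma_sets configurations ?E \<subseteq> sets vague_borel"
      using sets.sigma_sets_subset[of ?E vague_borel] by (simp add: space_vague_borel)
    have "pairing_cylinders \<subseteq> ?E"
    proof
      fix C :: "'a set set" assume "C \<in> pairing_cylinders"
      then obtain f U where "test_function f" "\<forall>x. 0 \<le> f x" "open U" "C = {\<omega> \<in> configurations. pairing f \<omega> \<in> U}"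
        unfolding pairing_cylinders_def by blast
      then show "C \<in> ?E"
        by (intro image_eqI[of _ _ "[(f, U)]"]) (auto simp: cylinder_def cylinder_base_def)
    qed
    then show "sets vague_borel \<subseteq> sigma_sets configurations ?E"
      unfolding sets_vague_borel_eq_cylinders[OF sc lc] by (rule sigma_sets_mono')
  qed
  show ?thesis
  proof (rule measure_eqI_generator_eq)
    show "Int_stable ?E"
    proof (rule Int_stableI)
      fix a b assume "a \<in> ?E" "b \<in> ?E"
      then obtain xs ys where "cylinder_base xs" "cylinder_base ys" "a = cylinder xs" "b = cylinder ys"
        by auto
      then show "a \<inter> b \<in> ?E"
        by (intro image_eqI[of _ _ "xs @ ys"]) (auto simp: cylinder_def cylinder_base_def)
    qed
    show "?E \<subseteq> Pow configurations"
      by (auto simp: cylinder_def)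
    show "sets P = sigma_sets configurations ?E" "sets Q = sigma_sets configurations ?E"
      using P(2) Q(2) sets by simp_all
    show "range (\<lambda>_::nat. cylinder []) \<subseteq> ?E"
      by (auto simp: cylinder_base_def)
    show "(\<Union>i::nat. cylinder [] :: 'a set set) = configurations"
      by (simp add: cylinder_def)
    show "emeasure P X = emeasure Q X" if "X \<in> ?E" for X
      using that by (auto simp: P.emeasure_eq_measure Q.emeasure_eq_measure eq)
  qed simp
qed

section \<open>Variance inequalities\<close>

definition poisson_weight :: "real \<Rightarrow> nat \<Rightarrow> real" where
  "poisson_weight s n = s ^ n / fact n * exp (- s)"

text \<open>The expectation of \<open>g(N)\<close> for \<open>N\<close> Poisson distributed with parameter \<open>s\<close>. The bound \<open>4 ^ n\<close> in the lemmas below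
is an integrability condition that admits \<open>n\<^sup>2\<close>.\<close>

definition poisson_mean :: "real \<Rightarrow> (nat \<Rightarrow> real) \<Rightarrow> real" where
  "poisson_mean s g = (\<Sum>n. poisson_weight s n * g n)"

lemma poisson_weight_nonneg: "0 \<le> s \<Longrightarrow> 0 \<le> poisson_weight s n"
  by (simp add: poisson_weight_def)

lemma poisson_mean_sums:
  assumes s: "0 < s" and g: "\<And>n. \<bar>g n\<bar> \<le> 4 ^ n"
  shows "(\<lambda>n. poisson_weight s n * g n) sums poisson_mean s g"
proof -
  have "summable (\<lambda>n. (4 * s) ^ n / fact n * exp (- s))"
    using summable_exp[of "4 * s"] by (intro summable_mult2) (simp add: field_simps)
  moreover have "norm (poisson_weight s n * g n) \<le> (4 * s) ^ n / fact n * exp (- s)" for n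
  proof -
    have "norm (poisson_weight s n * g n) = poisson_weight s n * \<bar>g n\<bar>"
      using s by (simp add: abs_mult poisson_weight_nonneg)
    also have "\<dots> \<le> poisson_weight s n * 4 ^ n"
      using s g by (intro mult_left_mono) (simp_all add: poisson_weight_nonneg)
    finally show ?thesis
      by (simp add: poisson_weight_def power_mult_distrib mult_ac)
  qed
  ultimately have "summable (\<lambda>n. poisson_weight s n * g n)"
    by (rule summable_comparison_test'[where N = 0])
  then show ?thesis
    unfolding poisson_mean_def by (rule summable_sums)
qed

lemma poisson_mean_power:
  assumes "0 < s"
  shows "poisson_mean s (\<lambda>n. t ^ n) = exp (s * (t - 1))"
proof -
  have "(\<lambda>n. poisson_weight s n * t ^ n) = (\<lambda>n. exp (- s) * ((s * t) ^ n /\<^sub>R fact n))"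
    by (simp add: poisson_weight_def power_mult_distrib field_simps)
  moreover have "(\<lambda>n. exp (- s) * ((s * t) ^ n /\<^sub>R fact n)) sums (exp (- s) * exp (s * t))"
    by (intro sums_mult exp_converges)
  ultimately show ?thesis
    unfolding poisson_mean_def by (simp add: sums_iff algebra_simps flip: exp_add)
qed

lemma le_4_power: "real n \<le> 4 ^ n" "real n * real n \<le> 4 ^ n" "1 \<le> (4::real) ^ n"
proof -
  have n: "real n \<le> 2 ^ n"
    using of_nat_less_two_power[of n, where 'a = real] by simp
  have "real n * real n \<le> 2 ^ n * 2 ^ n"
    using n by (intro mult_mono) auto
  then show "real n * real n \<le> 4 ^ n"
    by (simp flip: power_mult_distrib)
  show "1 \<le> (4::real) ^ n"
    by simp
  have "(2::real) ^ n \<le> 4 ^ n"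
    by (intro power_mono) auto
  then show "real n \<le> 4 ^ n"
    using n by linarith
qed

lemma poisson_mean_const: "0 < s \<Longrightarrow> poisson_mean s (\<lambda>_. 1) = 1"
  using poisson_mean_power[of s 1] by simp

lemma poisson_mean_mono:
  assumes "0 < s" "\<And>n. \<bar>g n\<bar> \<le> 4 ^ n" "\<And>n. \<bar>h n\<bar> \<le> 4 ^ n" "\<And>n. g n \<le> h n"
  shows "poisson_mean s g \<le> poisson_mean s h"
  using assms by (intro sums_le[OF _ poisson_mean_sums poisson_mean_sums] mult_left_mono poisson_weight_nonneg) auto

lemma poisson_mean_add:
  assumes "0 < s" "\<And>n. \<bar>g n\<bar> \<le> 4 ^ n" "\<And>n. \<bar>h n\<bar> \<le> 4 ^ n"
  shows "poisson_mean s (\<lambda>n. g n + h n) = poisson_mean s g + poisson_mean s h"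
  using sums_add[OF poisson_mean_sums[OF assms(1,2)] poisson_mean_sums[OF assms(1,3)]]
  unfolding poisson_mean_def[of s "\<lambda>n. g n + h n"] by (simp add: sums_iff distrib_left)

text \<open>The identity \<open>E N g(N) = s E g(N+1)\<close>, which characterizes the Poisson law.\<close>

lemma poisson_mean_Suc:
  assumes s: "0 < s" and g: "\<And>n. \<bar>real n * g n\<bar> \<le> 4 ^ n"
  shows "poisson_mean s (\<lambda>n. real n * g n) = s * poisson_mean s (\<lambda>n. g (Suc n))"
proof -
  have "(\<lambda>n. poisson_weight s n * (real n * g n)) sums poisson_mean s (\<lambda>n. real n * g n)"
    by (rule poisson_mean_sums[OF s g])
  then have sh: "(\<lambda>n. poisson_weight s (Suc n) * (real (Suc n) * g (Suc n))) sums poisson_mean s (\<lambda>n. real n * g n)"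
    using sums_Suc_iff[of "\<lambda>n. poisson_weight s n * (real n * g n)"] by simp
  have eq: "poisson_weight s (Suc n) * (real (Suc n) * g (Suc n)) = s * (poisson_weight s n * g (Suc n))" for n
    by (simp add: poisson_weight_def divide_simps del: of_nat_Suc)
  have *: "(\<lambda>n. s * (poisson_weight s n * g (Suc n))) sums poisson_mean s (\<lambda>n. real n * g n)"
    using sh unfolding eq .
  then have "summable (\<lambda>n. poisson_weight s n * g (Suc n))"
    using s by (auto simp: sums_iff summable_cmult_iff)
  then show ?thesis
    using * s unfolding poisson_mean_def[of s "\<lambda>n. g (Suc n)"] by (simp add: sums_iff suminf_mult)
qed

text \<open>Cauchy-Schwarz for the telescoping sum. The bound factorizes into differences of the two functions
\<open>n\<close> and \<open>S n\<close>, and both factors change sign together, so no order of \<open>m\<close> and \<open>n\<close> is assumed.\<close>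

lemma increment_square_le:
  fixes a :: "nat \<Rightarrow> real"
  defines "S \<equiv> \<lambda>n. \<Sum>k<n. (a (Suc k) - a k)\<^sup>2"
  shows "(a n - a m)\<^sup>2 \<le> (real n - real m) * (S n - S m)"
proof -
  have le: "(a n - a m)\<^sup>2 \<le> (real n - real m) * (S n - S m)" if "m \<le> n" for n m
  proof -
    have "a n - a m = (\<Sum>k\<in>{m..<n}. a (Suc k) - a k)"
      using that by (simp add: sum_Suc_diff')
    moreover have "S n - S m = (\<Sum>k\<in>{m..<n}. (a (Suc k) - a k)\<^sup>2)"
      unfolding S_def using that by (simp add: sum_diff_nat_ivl flip: atLeast0LessThan)
    ultimately show ?thesis
      using sum_squared_le_sum_of_squares[of "\<lambda>k. a (Suc k) - a k" "{m..<n}"] that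
      by (simp add: of_nat_diff mult.commute)
  qed
  show ?thesis
  proof (cases "m \<le> n")
    case False
    then show ?thesis
      using le[of n m] by (simp add: power2_commute[of "a n"] algebra_simps)
  qed (rule le)
qed

text \<open>Let \<open>M\<close> be an independent copy of \<open>N\<close> and \<open>S\<^sub>n\<close> the sum of the first \<open>n\<close> squared increments of \<open>a\<close>. Then
\<open>2 Var a\<^sub>N = E (a\<^sub>N - a\<^sub>M)\<^sup>2 \<le> E (N - M) (S\<^sub>N - S\<^sub>M) = 2 Cov (N, S\<^sub>N)\<close>,
and \<open>Cov (N, S\<^sub>N) = E N S\<^sub>N - s E S\<^sub>N = s E (S\<^bsub>N+1\<^esub> - S\<^sub>N)\<close>, the mean squared increment times \<open>s\<close>.\<close>

lemma poisson_poincare_nat: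
  fixes a :: "nat \<Rightarrow> real"
  assumes s: "0 < s" and a: "\<And>n. a n \<in> {0..1}"
  shows "poisson_mean s (\<lambda>n. (a n)\<^sup>2) - (poisson_mean s a)\<^sup>2 \<le> s * poisson_mean s (\<lambda>n. (a (Suc n) - a n)\<^sup>2)"
proof -
  define D where "D n = (a (Suc n) - a n)\<^sup>2" for n
  define S where "S n = (\<Sum>k<n. D k)" for n
  have D: "0 \<le> D n" "D n \<le> 1" for n
    using a[of n] a[of "Suc n"] unfolding D_def by (auto simp: power2_le_iff_abs_le abs_le_iff abs_square_le_1)
  have S: "0 \<le> S n" "S n \<le> real n" for n
    using D sum_mono[of "{..<n}" D "\<lambda>_. 1"] by (auto simp: S_def sum_nonneg)
  have nS: "\<bar>real n * S n\<bar> \<le> 4 ^ n" for n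
  proof -
    have "\<bar>real n * S n\<bar> \<le> real n * real n"
      using S[of n] by (simp add: abs_mult mult_left_mono)
    then show ?thesis
      using le_4_power(2)[of n] by linarith
  qed
  have a2: "\<bar>a n\<bar> \<le> 4 ^ n" "\<bar>(a n)\<^sup>2\<bar> \<le> 4 ^ n" "\<bar>D n\<bar> \<le> 4 ^ n" "\<bar>S n\<bar> \<le> 4 ^ n" for n
  proof -
    have "0 \<le> a n" "a n \<le> 1" "0 \<le> (a n)\<^sup>2" "(a n)\<^sup>2 \<le> 1"
      using a[of n] by (simp_all add: power_le_one)
    then show "\<bar>a n\<bar> \<le> 4 ^ n" "\<bar>(a n)\<^sup>2\<bar> \<le> 4 ^ n" "\<bar>D n\<bar> \<le> 4 ^ n" "\<bar>S n\<bar> \<le> 4 ^ n"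
      using D[of n] S[of n] le_4_power[of n] by linarith+
  qed
  let ?E = "poisson_mean s"
  note Ea = poisson_mean_sums[OF s a2(1)]
  note Ea2 = poisson_mean_sums[OF s a2(2)]
  note ES = poisson_mean_sums[OF s a2(4)]
  note ENS = poisson_mean_sums[OF s nS]
  have EN: "(\<lambda>n. poisson_weight s n * real n) sums s"
    using poisson_mean_sums[of s real] poisson_mean_Suc[of s "\<lambda>_. 1"] s le_4_power(1)
    by (simp add: poisson_mean_const)
  have E1: "(\<lambda>n. poisson_weight s n * 1) sums 1"
    using poisson_mean_sums[of s "\<lambda>_. 1"] s by (simp add: poisson_mean_const)
  have pair: "(a n - a m)\<^sup>2 \<le> (real n - real m) * (S n - S m)" for n m
    using increment_square_le[of a n m] by (simp add: S_def D_def)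
  \<comment> \<open>The expectation over \<open>N\<close> for a fixed value \<open>m\<close> of the copy; the next step averages over \<open>m\<close>.\<close>
  have one: "?E (\<lambda>n. (a n)\<^sup>2) - 2 * a m * ?E a + (a m)\<^sup>2
      \<le> ?E (\<lambda>n. real n * S n) - real m * ?E S - S m * s + real m * S m" for m
  proof (rule sums_le)
    show "(\<lambda>n. poisson_weight s n * (a n)\<^sup>2 - 2 * a m * (poisson_weight s n * a n) + (a m)\<^sup>2 * (poisson_weight s n * 1))
        sums (?E (\<lambda>n. (a n)\<^sup>2) - 2 * a m * ?E a + (a m)\<^sup>2)"
      using sums_add[OF sums_diff[OF Ea2 sums_mult[OF Ea, of "2 * a m"]] sums_mult[OF E1, of "(a m)\<^sup>2"]] by simp
    show "(\<lambda>n. poisson_weight s n * (real n * S n) - real m * (poisson_weight s n * S n)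
          - S m * (poisson_weight s n * real n) + real m * S m * (poisson_weight s n * 1))
        sums (?E (\<lambda>n. real n * S n) - real m * ?E S - S m * s + real m * S m)"
      using sums_add[OF sums_diff[OF sums_diff[OF ENS sums_mult[OF ES, of "real m"]] sums_mult[OF EN, of "S m"]]
          sums_mult[OF E1, of "real m * S m"]] by simp
    fix n
    have "poisson_weight s n * (a n - a m)\<^sup>2 \<le> poisson_weight s n * ((real n - real m) * (S n - S m))"
      using s by (intro mult_left_mono pair poisson_weight_nonneg) simp
    then show "poisson_weight s n * (a n)\<^sup>2 - 2 * a m * (poisson_weight s n * a n) + (a m)\<^sup>2 * (poisson_weight s n * 1)
      \<le> poisson_weight s n * (real n * S n) - real m * (poisson_weight s n * S n)
          - S m * (poisson_weight s n * real n) + real m * S m * (poisson_weight s n * 1)"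
      by (simp add: power2_eq_square algebra_simps)
  qed
  have "?E (\<lambda>n. (a n)\<^sup>2) - 2 * ?E a * ?E a + ?E (\<lambda>n. (a n)\<^sup>2)
      \<le> ?E (\<lambda>n. real n * S n) - ?E S * s - s * ?E S + ?E (\<lambda>n. real n * S n)"
  proof (rule sums_le)
    show "(\<lambda>m. ?E (\<lambda>n. (a n)\<^sup>2) * (poisson_weight s m * 1) - 2 * ?E a * (poisson_weight s m * a m) + poisson_weight s m * (a m)\<^sup>2)
        sums (?E (\<lambda>n. (a n)\<^sup>2) - 2 * ?E a * ?E a + ?E (\<lambda>n. (a n)\<^sup>2))"
      using sums_add[OF sums_diff[OF sums_mult[OF E1, of "?E (\<lambda>n. (a n)\<^sup>2)"] sums_mult[OF Ea, of "2 * ?E a"]] Ea2] by simp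
    show "(\<lambda>m. ?E (\<lambda>n. real n * S n) * (poisson_weight s m * 1) - ?E S * (poisson_weight s m * real m)
          - s * (poisson_weight s m * S m) + poisson_weight s m * (real m * S m))
        sums (?E (\<lambda>n. real n * S n) - ?E S * s - s * ?E S + ?E (\<lambda>n. real n * S n))"
      using sums_add[OF sums_diff[OF sums_diff[OF sums_mult[OF E1, of "?E (\<lambda>n. real n * S n)"] sums_mult[OF EN, of "?E S"]]
          sums_mult[OF ES, of s]] ENS] by simp
    fix m
    have "poisson_weight s m * (?E (\<lambda>n. (a n)\<^sup>2) - 2 * a m * ?E a + (a m)\<^sup>2)
      \<le> poisson_weight s m * (?E (\<lambda>n. real n * S n) - real m * ?E S - S m * s + real m * S m)"
      using s by (intro mult_left_mono one poisson_weight_nonneg) simp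
    then show "?E (\<lambda>n. (a n)\<^sup>2) * (poisson_weight s m * 1) - 2 * ?E a * (poisson_weight s m * a m) + poisson_weight s m * (a m)\<^sup>2
      \<le> ?E (\<lambda>n. real n * S n) * (poisson_weight s m * 1) - ?E S * (poisson_weight s m * real m)
          - s * (poisson_weight s m * S m) + poisson_weight s m * (real m * S m)"
      by (simp add: algebra_simps)
  qed
  moreover have "?E (\<lambda>n. real n * S n) = s * (?E S + ?E D)"
  proof -
    have SSuc: "S (Suc n) = S n + D n" for n
      by (simp add: S_def)
    have "?E (\<lambda>n. S (Suc n)) = ?E S + ?E D"
      using sums_add[OF ES poisson_mean_sums[OF s a2(3)]]
      unfolding poisson_mean_def[of s "\<lambda>n. S (Suc n)"] by (simp add: SSuc sums_iff distrib_left)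
    then show ?thesis
      using poisson_mean_Suc[OF s nS] by simp
  qed
  ultimately have "?E (\<lambda>n. (a n)\<^sup>2) - (?E a)\<^sup>2 \<le> s * ?E D"
    by (simp add: power2_eq_square algebra_simps)
  then show ?thesis
    unfolding D_def[abs_def] .
qed

text \<open>The subadditivity \<open>Var f \<le> E Var\<^sub>x f + E Var\<^sub>y f\<close> of the variance on a product space, after
cancelling the terms \<open>E f\<^sup>2\<close>. It holds because the interaction \<open>f - a - b + E f\<close> has a nonnegative
second moment, which equals \<open>E f\<^sup>2 - E a\<^sup>2 - E b\<^sup>2 + (E f)\<^sup>2\<close>.\<close>

lemma variance_tensorization:
  fixes f :: "'b \<times> 'c \<Rightarrow> real"
  assumes M: "prob_space M" and N: "prob_space N"
    and f: "f \<in> borel_measurable (M \<Otimes>\<^sub>M N)" and f01: "\<And>z. z \<in> space (M \<Otimes>\<^sub>M N) \<Longrightarrow> f z \<in> {0..1}"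
  defines "a \<equiv> \<lambda>x. \<integral>y. f (x, y) \<partial>N" and "b \<equiv> \<lambda>y. \<integral>x. f (x, y) \<partial>M"
  shows "(\<integral>x. (a x)\<^sup>2 \<partial>M) + (\<integral>y. (b y)\<^sup>2 \<partial>N) \<le> (\<integral>z. (f z)\<^sup>2 \<partial>(M \<Otimes>\<^sub>M N)) + (\<integral>x. a x \<partial>M)\<^sup>2"
proof -
  interpret M: prob_space M by fact
  interpret N: prob_space N by fact
  interpret P: pair_prob_space M N ..
  let ?P = "M \<Otimes>\<^sub>M N"
  have a_eq: "(\<integral>y. f (x, y) \<partial>N) = a x" and b_eq: "(\<integral>x. f (x, y) \<partial>M) = b y" for x y
    by (simp_all add: a_def b_def)
  have a01: "a x \<in> {0..1}" if x: "x \<in> space M" for x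
  proof -
    have "0 \<le> a x"
      unfolding a_def using f01 x by (intro Bochner_Integration.integral_nonneg) (auto simp: space_pair_measure)
    moreover have "a x \<le> (\<integral>y. 1 \<partial>N)"
      unfolding a_def using f01 x measurable_compose[OF measurable_Pair1'[OF x] f]
      by (intro integral_mono N.integrable_const_bound[where B = 1]) (auto simp: space_pair_measure intro!: AE_I2)
    ultimately show ?thesis by (simp add: N.prob_space)
  qed
  have b01: "b y \<in> {0..1}" if y: "y \<in> space N" for y
  proof -
    have "0 \<le> b y"
      unfolding b_def using f01 y by (intro Bochner_Integration.integral_nonneg) (auto simp: space_pair_measure)
    moreover have "b y \<le> (\<integral>x. 1 \<partial>M)"
      unfolding b_def using f01 y measurable_compose[OF measurable_Pair2'[OF y] f]
      by (intro integral_mono M.integrable_const_bound[where B = 1]) (auto simp: space_pair_measure intro!: AE_I2)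
    ultimately show ?thesis by (simp add: M.prob_space)
  qed
  have am: "a \<in> borel_measurable M"
    unfolding a_def using f by (intro N.borel_measurable_lebesgue_integral) simp
  have bm: "b \<in> borel_measurable N"
    unfolding b_def
    by (rule M.borel_measurable_lebesgue_integral)
       (use measurable_compose[OF measurable_pair_swap' f] in \<open>simp add: split_beta' case_prod_unfold\<close>)
  have amP: "(\<lambda>z. a (fst z)) \<in> borel_measurable ?P" and bmP: "(\<lambda>z. b (snd z)) \<in> borel_measurable ?P"
    by (intro measurable_compose[OF measurable_fst am] measurable_compose[OF measurable_snd bm])+
  have int: "integrable ?P (\<lambda>z. g z * h z)"
    if "g \<in> borel_measurable ?P" "h \<in> borel_measurable ?P"
      "\<And>z. z \<in> space ?P \<Longrightarrow> g z \<in> {0..1}" "\<And>z. z \<in> space ?P \<Longrightarrow> h z \<in> {0..1}" for g h :: "_ \<Rightarrow> real"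
    using that by (intro P.P.integrable_const_bound[where B = 1] AE_I2) (auto simp: abs_mult intro!: mult_le_one)
  have sp: "a (fst z) \<in> {0..1}" "b (snd z) \<in> {0..1}" if "z \<in> space ?P" for z
    using that a01 b01 by (auto simp: space_pair_measure)
  have one: "(\<lambda>_. 1) \<in> borel_measurable ?P" by simp
  note iff = int[OF f f f01 f01] and ifa = int[OF f amP f01 sp(1)] and ifb = int[OF f bmP f01 sp(2)]
    and iaa = int[OF amP amP sp(1) sp(1)] and ibb = int[OF bmP bmP sp(2) sp(2)]
    and iab = int[OF amP bmP sp(1) sp(2)]
  have i1: "integrable ?P f" "integrable ?P (\<lambda>z. a (fst z))" "integrable ?P (\<lambda>z. b (snd z))"
    using int[OF f one f01] int[OF amP one sp(1)] int[OF bmP one sp(2)] by simp_all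
  define m where "m = (\<integral>x. a x \<partial>M)"
  have mf: "(\<integral>z. f z \<partial>?P) = m"
    using P.integral_fst'[OF i1(1)] by (simp add: m_def a_eq)
  have ma: "(\<integral>z. a (fst z) \<partial>?P) = m"
    using P.integral_fst'[OF i1(2)] by (simp add: m_def N.prob_space)
  have mb: "(\<integral>y. b y \<partial>N) = m"
  proof -
    have "integrable ?P (\<lambda>(x, y). f (x, y))"
      using i1(1) by simp
    from P.integral_snd[OF this] show ?thesis
      by (simp add: b_eq mf)
  qed
  have mb': "(\<integral>z. b (snd z) \<partial>?P) = m"
    using P.integral_fst'[OF i1(3)] by (simp add: mb M.prob_space)
  have mfa: "(\<integral>z. f z * a (fst z) \<partial>?P) = (\<integral>x. (a x)\<^sup>2 \<partial>M)"
    using P.integral_fst'[OF ifa] by (simp add: a_eq power2_eq_square)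
  have mfb: "(\<integral>z. f z * b (snd z) \<partial>?P) = (\<integral>y. (b y)\<^sup>2 \<partial>N)"
  proof -
    have "integrable ?P (\<lambda>(x, y). f (x, y) * b y)"
      using ifb by (simp add: case_prod_unfold)
    from P.integral_snd[OF this] show ?thesis
      by (simp add: b_eq power2_eq_square case_prod_unfold)
  qed
  have maa: "(\<integral>z. a (fst z) * a (fst z) \<partial>?P) = (\<integral>x. (a x)\<^sup>2 \<partial>M)"
    using P.integral_fst'[OF iaa] by (simp add: N.prob_space power2_eq_square)
  have mbb: "(\<integral>z. b (snd z) * b (snd z) \<partial>?P) = (\<integral>y. (b y)\<^sup>2 \<partial>N)"
    using P.integral_fst'[OF ibb] by (simp add: M.prob_space power2_eq_square)
  have mab: "(\<integral>z. a (fst z) * b (snd z) \<partial>?P) = m * m"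
    using P.integral_fst'[OF iab] by (simp add: mb m_def)
  have "0 \<le> (\<integral>z. (f z - a (fst z) - b (snd z) + m)\<^sup>2 \<partial>?P)"
    by simp
  also have "(\<integral>z. (f z - a (fst z) - b (snd z) + m)\<^sup>2 \<partial>?P) =
    (\<integral>z. f z * f z + a (fst z) * a (fst z) + b (snd z) * b (snd z) + m * m - 2 * (f z * a (fst z)) - 2 * (f z * b (snd z))
       + 2 * m * f z + 2 * (a (fst z) * b (snd z)) - 2 * m * a (fst z) - 2 * m * b (snd z) \<partial>?P)"
    by (intro Bochner_Integration.integral_cong) (simp_all add: power2_eq_square algebra_simps)
  also have "\<dots> = (\<integral>z. f z * f z \<partial>?P) + (\<integral>x. (a x)\<^sup>2 \<partial>M) + (\<integral>y. (b y)\<^sup>2 \<partial>N) + m * m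
      - 2 * (\<integral>x. (a x)\<^sup>2 \<partial>M) - 2 * (\<integral>y. (b y)\<^sup>2 \<partial>N) + 2 * m * m + 2 * (m * m) - 2 * m * m - 2 * m * m"
    using iff ifa ifb iaa ibb iab i1
    by (simp add: mf ma mb' mfa mfb maa mbb mab P.P.prob_space)
  finally show ?thesis
    by (simp add: power2_eq_square m_def algebra_simps)
qed

section \<open>Independent points\<close>

lemma unit_integrable:
  fixes f :: "'b \<Rightarrow> real"
  assumes "prob_space M" "f \<in> borel_measurable M" "\<And>x. x \<in> space M \<Longrightarrow> f x \<in> {0..1}"
  shows "integrable M f"
proof -
  interpret prob_space M by fact
  show ?thesis
    using assms(2,3) by (intro integrable_const_bound[where B = 1] AE_I2) auto
qed

lemma unit_integral:
  fixes f :: "'b \<Rightarrow> real"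
  assumes "prob_space M" "f \<in> borel_measurable M" "\<And>x. x \<in> space M \<Longrightarrow> f x \<in> {0..1}"
  shows "(\<integral>x. f x \<partial>M) \<in> {0..1}"
proof -
  interpret prob_space M by fact
  have "(\<integral>x. f x \<partial>M) \<le> (\<integral>x. 1 \<partial>M)"
    using unit_integrable[OF assms] assms(3) by (intro integral_mono) auto
  moreover have "0 \<le> (\<integral>x. f x \<partial>M)"
    using assms(3) by (intro Bochner_Integration.integral_nonneg) auto
  ultimately show ?thesis
    by (simp add: prob_space)
qed

text \<open>The law of the set of \<open>n\<close> independent points. Building it by adding one point at a time makes
configurations the only objects to be handled; the symmetry in the points is built in,
since a configuration is a set.\<close>

primrec iid_points :: "'a::metric_space measure \<Rightarrow> nat \<Rightarrow> 'a set measure" where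
  "iid_points \<pi> 0 = return vague_borel {}"
| "iid_points \<pi> (Suc n) = distr (\<pi> \<Otimes>\<^sub>M iid_points \<pi> n) vague_borel (\<lambda>(x, \<omega>). insert x \<omega>)"

text \<open>The probability that \<open>\<omega>\<close> with one more random point lies in \<open>A\<close>. Then \<open>q (1 - q)\<close>, for \<open>q\<close> this probability,
is the variance of the indicator of \<open>A\<close> over that point.\<close>

definition hit_prob :: "'a measure \<Rightarrow> 'a set set \<Rightarrow> 'a set \<Rightarrow> real" where
  "hit_prob \<pi> A \<omega> = (\<integral>x. indicator A (insert x \<omega>) \<partial>\<pi>)"

text \<open>The surface measure of \<open>A\<close> is \<open>\<sigma>(\<Lambda>)\<close> times the expectation of this function.\<close>

definition mean_flip :: "'a measure \<Rightarrow> 'a set set \<Rightarrow> 'a set \<Rightarrow> real" where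
  "mean_flip \<pi> A \<omega> = (\<integral>x. \<bar>indicat_real A (insert x \<omega>) - indicat_real A \<omega>\<bar> \<partial>\<pi>)"

definition poisson_mixture :: "real \<Rightarrow> 'a::metric_space measure \<Rightarrow> 'a set measure" where
  "poisson_mixture s \<pi> = measure_pmf (poisson_pmf s) \<bind> iid_points \<pi>"

context
  fixes \<pi> :: "'a::metric_space measure"
  assumes sc: "sigma_compact (UNIV :: 'a set)"
    and lc: "locally compact (UNIV :: 'a set)"
    and \<pi>: "prob_space \<pi>" and sets_\<pi>: "sets \<pi> = sets borel"
begin

lemma sets_iid_points: "sets (iid_points \<pi> n) = sets vague_borel"
  by (cases n) simp_all

lemma space_iid_points: "space (iid_points \<pi> n) = configurations"
  using sets_eq_imp_space_eq[OF sets_iid_points] by (simp add: space_vague_borel)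

lemma space_\<pi>: "space \<pi> = UNIV"
  using sets_eq_imp_space_eq[OF sets_\<pi>] by simp

lemma insert_measurable_iid:
  assumes "sets N = sets vague_borel"
  shows "(\<lambda>(x, \<omega>). insert x \<omega>) \<in> \<pi> \<Otimes>\<^sub>M N \<rightarrow>\<^sub>M vague_borel"
  using insert_measurable[OF sc lc] measurable_cong_sets[OF sets_pair_measure_cong[OF sets_\<pi> assms] refl] by blast

lemma prob_space_iid_points: "prob_space (iid_points \<pi> n)"
proof (induction n)
  case 0
  show ?case by (simp add: prob_space_return space_vague_borel empty_configuration)
next
  case (Suc n)
  interpret M: prob_space \<pi> by (rule \<pi>)
  interpret N: prob_space "iid_points \<pi> n" by (rule Suc)
  interpret P: pair_prob_space \<pi> "iid_points \<pi> n" ..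
  show ?case
    by (simp add: P.P.prob_space_distr insert_measurable_iid[OF sets_iid_points])
qed

lemma insert_comp_measurable:
  assumes "f \<in> borel_measurable vague_borel" "sets N = sets vague_borel"
  shows "(\<lambda>(x, \<omega>). f (insert x \<omega>)) \<in> borel_measurable (\<pi> \<Otimes>\<^sub>M N)"
  using measurable_compose[OF insert_measurable_iid[OF assms(2)] assms(1)] by (simp add: case_prod_unfold)

lemma insert_point_comp_measurable:
  assumes "f \<in> borel_measurable vague_borel"
  shows "(\<lambda>\<omega>. f (insert x \<omega>)) \<in> borel_measurable (vague_borel :: 'a set measure)"
  using measurable_compose[OF measurable_Pair1'[of x \<pi> vague_borel] insert_comp_measurable[OF assms refl]]
  by (simp add: space_\<pi>)

text \<open>The new point can be integrated out last, which serves for inductions that condition on it, or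
first, which gives integrals of functions like \<open>hit_prob\<close>.\<close>

lemma integral_iid_points_Suc:
  fixes f :: "'a set \<Rightarrow> real"
  assumes f: "f \<in> borel_measurable vague_borel" and f01: "\<And>\<omega>. \<omega> \<in> configurations \<Longrightarrow> f \<omega> \<in> {0..1}"
  shows "(\<integral>\<omega>. f \<omega> \<partial>iid_points \<pi> (Suc n)) = (\<integral>x. \<integral>\<omega>. f (insert x \<omega>) \<partial>iid_points \<pi> n \<partial>\<pi>)"
    and "(\<integral>\<omega>. f \<omega> \<partial>iid_points \<pi> (Suc n)) = (\<integral>\<omega>. \<integral>x. f (insert x \<omega>) \<partial>\<pi> \<partial>iid_points \<pi> n)"
proof -
  interpret M: prob_space \<pi> by (rule \<pi>)
  interpret N: prob_space "iid_points \<pi> n" by (rule prob_space_iid_points)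
  interpret P: pair_prob_space \<pi> "iid_points \<pi> n" ..
  have int: "integrable (\<pi> \<Otimes>\<^sub>M iid_points \<pi> n) (\<lambda>(x, \<omega>). f (insert x \<omega>))"
    using f01 insert_comp_measurable[OF f sets_iid_points[of n]]
    by (intro unit_integrable P.P.prob_space_axioms) (auto simp: space_pair_measure space_iid_points insert_configuration)
  have "(\<integral>\<omega>. f \<omega> \<partial>iid_points \<pi> (Suc n)) = (\<integral>z. f ((\<lambda>(x, \<omega>). insert x \<omega>) z) \<partial>(\<pi> \<Otimes>\<^sub>M iid_points \<pi> n))"
    unfolding iid_points.simps by (rule integral_distr[OF insert_measurable_iid[OF sets_iid_points] f])
  then have eq: "(\<integral>\<omega>. f \<omega> \<partial>iid_points \<pi> (Suc n)) = (\<integral>z. (case z of (x, \<omega>) \<Rightarrow> f (insert x \<omega>)) \<partial>(\<pi> \<Otimes>\<^sub>M iid_points \<pi> n))"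
    by (simp add: case_prod_unfold)
  show "(\<integral>\<omega>. f \<omega> \<partial>iid_points \<pi> (Suc n)) = (\<integral>x. \<integral>\<omega>. f (insert x \<omega>) \<partial>iid_points \<pi> n \<partial>\<pi>)"
    unfolding eq using P.integral_fst'[OF int] by simp
  show "(\<integral>\<omega>. f \<omega> \<partial>iid_points \<pi> (Suc n)) = (\<integral>\<omega>. \<integral>x. f (insert x \<omega>) \<partial>\<pi> \<partial>iid_points \<pi> n)"
    unfolding eq using P.integral_snd[OF int] by simp
qed

lemma insert_point_measurable:
  assumes "A \<in> sets vague_borel"
  shows "{\<omega> \<in> configurations. insert x \<omega> \<in> A} \<in> sets (vague_borel :: 'a set measure)"
proof -
  have "indicat_real A \<in> borel_measurable vague_borel"
    using assms by simp
  from measurable_sets[OF insert_point_comp_measurable[OF this, of x], of "{1}"] show ?thesis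
    by (simp add: vimage_def Int_def indicator_eq_1_iff space_vague_borel conj_commute)
qed

lemma hit_prob_measurable:
  assumes "A \<in> sets vague_borel"
  shows "hit_prob \<pi> A \<in> borel_measurable (vague_borel :: 'a set measure)"
proof -
  interpret M: prob_space \<pi> by (rule \<pi>)
  have "indicat_real A \<in> borel_measurable vague_borel"
    using assms by simp
  note m = insert_comp_measurable[OF this refl]
  show ?thesis
    unfolding hit_prob_def[abs_def]
    by (rule M.borel_measurable_lebesgue_integral)
       (use measurable_compose[OF measurable_pair_swap' m] in \<open>simp add: case_prod_unfold\<close>)
qed

lemma hit_prob_unit:
  assumes A: "A \<in> sets vague_borel" and \<omega>: "\<omega> \<in> configurations"
  shows "hit_prob \<pi> A \<omega> \<in> {0..1}" "(\<lambda>x. indicat_real A (insert x \<omega>)) \<in> borel_measurable \<pi>"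
proof -
  have "indicat_real A \<in> borel_measurable vague_borel"
    using A by simp
  from measurable_compose[OF measurable_Pair2'[of \<omega> vague_borel \<pi>] insert_comp_measurable[OF this refl]]
  show m: "(\<lambda>x. indicat_real A (insert x \<omega>)) \<in> borel_measurable \<pi>"
    using \<omega> by (simp add: space_vague_borel)
  show "hit_prob \<pi> A \<omega> \<in> {0..1}"
    unfolding hit_prob_def by (rule unit_integral[OF \<pi> m]) (simp add: indicator_def)
qed

lemma measure_iid_points_Suc:
  assumes A: "A \<in> sets vague_borel"
  shows "measure (iid_points \<pi> (Suc n)) A = (\<integral>\<omega>. hit_prob \<pi> A \<omega> \<partial>iid_points \<pi> n)"
proof -
  have "measure (iid_points \<pi> (Suc n)) A = (\<integral>\<omega>. indicator A \<omega> \<partial>iid_points \<pi> (Suc n))"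
    using A sets_iid_points[of "Suc n"] by (simp add: sets.Int_space_eq2 del: iid_points.simps)
  also have "\<dots> = (\<integral>\<omega>. hit_prob \<pi> A \<omega> \<partial>iid_points \<pi> n)"
    unfolding hit_prob_def using A by (intro integral_iid_points_Suc(2)) (simp_all add: indicator_def)
  finally show ?thesis .
qed

text \<open>The Efron-Stein inequality for the indicator of \<open>A\<close> as a function of independent points. Of \<open>n + 1\<close> points, split off
one point \<open>x\<close> from the other \<open>n\<close> and tensorize the variance. The variance over \<open>x\<close> alone gives one term of the
required form. The variance over the other \<open>n\<close> points, with \<open>x\<close> fixed, is the same problem for the event
\<open>A' x\<close> that adding \<open>x\<close> leads into \<open>A\<close>; after applying the induction hypothesis, \<open>x\<close> and the remaining \<open>n - 1\<close>
points together are \<open>n\<close> independent points, because insertions commute. This contributes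
\<open>n\<close> more terms, all equal to the first.\<close>

lemma efron_stein_iid_points:
  assumes "A \<in> sets vague_borel"
  shows "measure (iid_points \<pi> n) A * (1 - measure (iid_points \<pi> n) A) \<le>
    real n * (\<integral>\<omega>. hit_prob \<pi> A \<omega> * (1 - hit_prob \<pi> A \<omega>) \<partial>iid_points \<pi> (n - 1))"
  using assms
proof (induction n arbitrary: A)
  case 0
  then have "measure (iid_points \<pi> 0) A = indicator A {}"
    by (simp add: measure_return)
  then show ?case
    by (simp add: indicator_def)
next
  case (Suc n)
  let ?R = "iid_points \<pi> n"
  let ?v = "\<lambda>A \<omega>. hit_prob \<pi> A \<omega> * (1 - hit_prob \<pi> A \<omega>)"
  interpret M: prob_space \<pi> by (rule \<pi>)
  interpret N: prob_space ?R by (rule prob_space_iid_points)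
  interpret P: pair_prob_space \<pi> ?R ..
  define f where "f = (\<lambda>(x, \<omega>). indicat_real A (insert x \<omega>))"
  define A' where "A' x = {\<omega> \<in> configurations. insert x \<omega> \<in> A}" for x
  have A': "A' x \<in> sets vague_borel" for x
    unfolding A'_def by (rule insert_point_measurable[OF Suc.prems])
  have Am: "indicat_real A \<in> borel_measurable vague_borel"
    using Suc.prems by simp
  have fm: "f \<in> borel_measurable (\<pi> \<Otimes>\<^sub>M ?R)"
    unfolding f_def by (rule insert_comp_measurable[OF Am sets_iid_points])
  have f01: "f z \<in> {0..1}" for z
    by (simp add: f_def indicator_def case_prod_unfold)
  define a where "a x = measure ?R (A' x)" for x
  have fa: "(\<integral>\<omega>. f (x, \<omega>) \<partial>?R) = a x" for x
  proof -
    have "(\<integral>\<omega>. f (x, \<omega>) \<partial>?R) = (\<integral>\<omega>. indicator (A' x) \<omega> \<partial>?R)"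
      by (intro Bochner_Integration.integral_cong) (simp_all add: f_def A'_def indicator_def space_iid_points)
    also have "\<dots> = a x"
      using A'[of x] sets_iid_points[of n] by (simp add: a_def sets.Int_space_eq2)
    finally show ?thesis .
  qed
  have fb: "(\<integral>x. f (x, \<omega>) \<partial>\<pi>) = hit_prob \<pi> A \<omega>" for \<omega>
    by (simp add: f_def hit_prob_def)
  have am: "a \<in> borel_measurable \<pi>"
    unfolding fa[symmetric, abs_def] using fm by (intro N.borel_measurable_lebesgue_integral) simp
  have a01: "a x \<in> {0..1}" for x
    by (simp add: a_def)
  have ia: "integrable \<pi> a" "integrable \<pi> (\<lambda>x. (a x)\<^sup>2)"
    using am a01 by (auto intro!: unit_integrable[OF \<pi>] simp: power_le_one)
  have hm: "hit_prob \<pi> B \<in> borel_measurable ?R" if "B \<in> sets vague_borel" for B n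
    using hit_prob_measurable[OF that] measurable_cong_sets[OF sets_iid_points refl] by blast
  have ib: "integrable ?R (hit_prob \<pi> A)" "integrable ?R (\<lambda>\<omega>. (hit_prob \<pi> A \<omega>)\<^sup>2)"
    using hm[OF Suc.prems] hit_prob_unit(1)[OF Suc.prems]
    by (auto intro!: unit_integrable[OF prob_space_iid_points] simp: power_le_one space_iid_points)
  have vm: "?v B \<in> borel_measurable vague_borel" if "B \<in> sets vague_borel" for B
    using hit_prob_measurable[OF that] by simp
  have v01: "?v B \<omega> \<in> {0..1}" if "B \<in> sets vague_borel" "\<omega> \<in> configurations" for B \<omega>
    using hit_prob_unit(1)[OF that] by (auto intro!: mult_le_one)
  let ?m = "measure (iid_points \<pi> (Suc n)) A"
  have m: "?m = (\<integral>x. a x \<partial>\<pi>)" "?m = (\<integral>\<omega>. hit_prob \<pi> A \<omega> \<partial>?R)" "?m = (\<integral>z. (f z)\<^sup>2 \<partial>(\<pi> \<Otimes>\<^sub>M ?R))"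
  proof -
    show m2: "?m = (\<integral>\<omega>. hit_prob \<pi> A \<omega> \<partial>?R)"
      by (rule measure_iid_points_Suc[OF Suc.prems])
    have intf: "integrable (\<pi> \<Otimes>\<^sub>M ?R) f"
      using fm by (intro unit_integrable P.P.prob_space_axioms) (auto simp: f_def indicator_def)
    have mf: "?m = (\<integral>z. f z \<partial>(\<pi> \<Otimes>\<^sub>M ?R))"
      unfolding m2 using P.integral_snd[of "\<lambda>x \<omega>. f (x, \<omega>)"] intf by (simp add: fb)
    have sq: "(f z)\<^sup>2 = f z" for z
      by (simp add: f_def indicator_def case_prod_unfold)
    show "?m = (\<integral>z. (f z)\<^sup>2 \<partial>(\<pi> \<Otimes>\<^sub>M ?R))"
      unfolding sq by (rule mf)
    show "?m = (\<integral>x. a x \<partial>\<pi>)"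
      using P.integral_fst'[OF intf] by (simp add: fa mf del: iid_points.simps)
  qed
  have "(\<integral>x. (a x)\<^sup>2 \<partial>\<pi>) + (\<integral>\<omega>. (hit_prob \<pi> A \<omega>)\<^sup>2 \<partial>?R) \<le> ?m + ?m\<^sup>2"
    using variance_tensorization[OF \<pi> prob_space_iid_points fm f01]
    unfolding fa fb m(1)[symmetric] m(3)[symmetric] .
  moreover have "(\<integral>x. a x * (1 - a x) \<partial>\<pi>) = ?m - (\<integral>x. (a x)\<^sup>2 \<partial>\<pi>)"
    unfolding m(1) using ia by (simp add: right_diff_distrib power2_eq_square)
  moreover have "(\<integral>\<omega>. ?v A \<omega> \<partial>?R) = ?m - (\<integral>\<omega>. (hit_prob \<pi> A \<omega>)\<^sup>2 \<partial>?R)"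
    unfolding m(2) using ib by (simp add: right_diff_distrib power2_eq_square)
  ultimately have tensor: "?m * (1 - ?m) \<le> (\<integral>x. a x * (1 - a x) \<partial>\<pi>) + (\<integral>\<omega>. ?v A \<omega> \<partial>?R)"
    by (simp add: right_diff_distrib power2_eq_square)
  also have "(\<integral>x. a x * (1 - a x) \<partial>\<pi>) \<le> real n * (\<integral>\<omega>. ?v A \<omega> \<partial>?R)"
  proof (cases n)
    case 0
    \<comment> \<open>For \<open>n = 0\<close> there is no other point: the event is decided by \<open>x\<close>.\<close>
    have "a x * (1 - a x) = 0" for x
    proof (rule antisym)
      show "a x * (1 - a x) \<le> 0"
        using Suc.IH[OF A'[of x], folded a_def] by (simp add: 0)
      show "0 \<le> a x * (1 - a x)"
        using a01[of x] by simp
    qed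
    then show ?thesis by (simp only: 0) simp
  next
    case (Suc k)
    have hit: "hit_prob \<pi> (A' x) \<omega> = hit_prob \<pi> A (insert x \<omega>)" if "\<omega> \<in> configurations" for x \<omega>
      using that by (simp add: hit_prob_def A'_def indicator_def insert_configuration insert_commute)
    have IH: "a x * (1 - a x) \<le> real n * (\<integral>\<omega>. ?v A (insert x \<omega>) \<partial>iid_points \<pi> k)" for x
    proof -
      have "a x * (1 - a x) \<le> real n * (\<integral>\<omega>. ?v (A' x) \<omega> \<partial>iid_points \<pi> k)"
        using Suc.IH[OF A'[of x]] by (simp add: a_def Suc)
      also have "(\<integral>\<omega>. ?v (A' x) \<omega> \<partial>iid_points \<pi> k) = (\<integral>\<omega>. ?v A (insert x \<omega>) \<partial>iid_points \<pi> k)"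
        by (intro Bochner_Integration.integral_cong) (simp_all add: hit space_iid_points)
      finally show ?thesis .
    qed
    let ?w = "\<lambda>x. \<integral>\<omega>. ?v A (insert x \<omega>) \<partial>iid_points \<pi> k"
    interpret K: prob_space "iid_points \<pi> k" by (rule prob_space_iid_points)
    have wm: "?w \<in> borel_measurable \<pi>"
      using insert_comp_measurable[OF vm[OF Suc.prems] sets_iid_points[of k]]
      by (intro K.borel_measurable_lebesgue_integral)
    have "?w x \<in> {0..1}" for x
    proof (rule unit_integral[OF prob_space_iid_points])
      show "(\<lambda>\<omega>. ?v A (insert x \<omega>)) \<in> borel_measurable (iid_points \<pi> k)"
        using insert_point_comp_measurable[OF vm[OF Suc.prems]] measurable_cong_sets[OF sets_iid_points refl] by blast
      show "?v A (insert x \<omega>) \<in> {0..1}" if "\<omega> \<in> space (iid_points \<pi> k)" for \<omega>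
        using that v01[OF Suc.prems] by (simp add: space_iid_points insert_configuration)
    qed
    then have iw: "integrable \<pi> ?w"
      by (intro unit_integrable[OF \<pi> wm])
    have "integrable \<pi> (\<lambda>x. a x * (1 - a x))"
      using ia by (simp add: right_diff_distrib power2_eq_square)
    then have "(\<integral>x. a x * (1 - a x) \<partial>\<pi>) \<le> (\<integral>x. real n * ?w x \<partial>\<pi>)"
      by (intro integral_mono integrable_mult_right iw IH)
    also have "\<dots> = real n * (\<integral>x. ?w x \<partial>\<pi>)"
      by simp
    also have "(\<integral>x. ?w x \<partial>\<pi>) = (\<integral>\<omega>. ?v A \<omega> \<partial>?R)"
      unfolding Suc using v01[OF Suc.prems] by (intro integral_iid_points_Suc(1)[symmetric] vm[OF Suc.prems])
    finally show ?thesis .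
  qed
  finally show ?case
    by (simp add: algebra_simps)
qed

section \<open>A Poisson number of independent points\<close>

lemma iid_points_kernel: "iid_points \<pi> \<in> measure_pmf p \<rightarrow>\<^sub>M subprob_algebra vague_borel"
  using prob_space_imp_subprob_space[OF prob_space_iid_points]
  by (simp add: space_subprob_algebra sets_iid_points)

lemma sets_poisson_mixture: "sets (poisson_mixture s \<pi>) = sets vague_borel"
  unfolding poisson_mixture_def by (rule sets_bind) (simp_all add: sets_iid_points)

lemma space_poisson_mixture: "space (poisson_mixture s \<pi>) = configurations"
  using sets_eq_imp_space_eq[OF sets_poisson_mixture] by (simp add: space_vague_borel)

lemma prob_space_poisson_mixture: "prob_space (poisson_mixture s \<pi>)"
  unfolding poisson_mixture_def
  by (rule measure_pmf.prob_space_bind[OF _ iid_points_kernel]) (simp add: prob_space_iid_points)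

lemma integral_poisson_mixture:
  fixes g :: "'a set \<Rightarrow> real"
  assumes s: "0 < s" and g: "g \<in> borel_measurable vague_borel"
    and g01: "\<And>\<omega>. \<omega> \<in> configurations \<Longrightarrow> g \<omega> \<in> {0..1}"
  shows "(\<integral>\<omega>. g \<omega> \<partial>poisson_mixture s \<pi>) = poisson_mean s (\<lambda>n. \<integral>\<omega>. g \<omega> \<partial>iid_points \<pi> n)"
proof -
  define G where "G n = (\<integral>\<omega>. g \<omega> \<partial>iid_points \<pi> n)" for n
  have gm: "g \<in> borel_measurable (iid_points \<pi> n)" for n
    using g measurable_cong_sets[OF sets_iid_points refl] by blast
  have G: "G n \<in> {0..1}" for n
    unfolding G_def using gm g01 by (intro unit_integral prob_space_iid_points) (simp_all add: space_iid_points)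
  have sums: "(\<lambda>n. poisson_weight s n * G n) sums poisson_mean s G"
    using G le_4_power(3) by (intro poisson_mean_sums[OF s]) (metis abs_of_nonneg atLeastAtMost_iff order_trans)
  have "(\<integral>\<^sup>+\<omega>. g \<omega> \<partial>poisson_mixture s \<pi>) = (\<integral>\<^sup>+n. \<integral>\<^sup>+\<omega>. g \<omega> \<partial>iid_points \<pi> n \<partial>measure_pmf (poisson_pmf s))"
    unfolding poisson_mixture_def using g by (intro nn_integral_bind[OF _ iid_points_kernel]) simp
  also have "\<dots> = (\<integral>\<^sup>+n. ennreal (G n) \<partial>measure_pmf (poisson_pmf s))"
  proof (intro nn_integral_cong)
    fix n
    show "(\<integral>\<^sup>+\<omega>. g \<omega> \<partial>iid_points \<pi> n) = ennreal (G n)"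
      unfolding G_def using g01
      by (intro nn_integral_eq_integral unit_integrable[OF prob_space_iid_points gm] AE_I2)
         (simp_all add: space_iid_points)
  qed
  also have "\<dots> = (\<Sum>n. ennreal (poisson_weight s n * G n))"
  proof -
    have "ennreal (pmf (poisson_pmf s) n) * ennreal (G n) = ennreal (poisson_weight s n * G n)" for n
      using s G[of n] poisson_weight_nonneg[of s n] by (subst ennreal_mult) (simp_all add: poisson_weight_def)
    then show ?thesis
      by (simp only: nn_integral_measure_pmf nn_integral_count_space_nat)
  qed
  also have "\<dots> = ennreal (poisson_mean s G)"
    using sums s G unfolding poisson_mean_def
    by (intro suminf_ennreal2) (auto simp: sums_iff poisson_weight_nonneg)
  finally have nn: "(\<integral>\<^sup>+\<omega>. g \<omega> \<partial>poisson_mixture s \<pi>) = ennreal (poisson_mean s G)" .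
  have "0 \<le> poisson_mean s G"
    using sums s G by (intro sums_le[OF _ sums_zero sums]) (simp add: poisson_weight_nonneg)
  moreover have "(\<integral>\<omega>. g \<omega> \<partial>poisson_mixture s \<pi>) = enn2real (\<integral>\<^sup>+\<omega>. g \<omega> \<partial>poisson_mixture s \<pi>)"
    using g g01 measurable_cong_sets[OF sets_poisson_mixture refl]
    by (intro integral_eq_nn_integral AE_I2) (auto simp: space_poisson_mixture)
  ultimately show ?thesis
    by (simp add: nn G_def[abs_def])
qed

text \<open>Configurations are countable because the space is a countable union of compact sets.\<close>

lemma AE_not_in_configuration:
  assumes diffuse: "\<And>x. emeasure \<pi> {x} = 0" and \<omega>: "\<omega> \<in> configurations"
  shows "AE x in \<pi>. x \<notin> \<omega>"
proof -
  have "AE x in \<pi>. x \<notin> {y}" for y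
    by (rule AE_not_in) (simp add: null_sets_def diffuse sets_\<pi>)
  then have "AE x in \<pi>. \<forall>y\<in>\<omega>. x \<notin> {y}"
    by (subst AE_ball_countable[OF configurations_countable[OF sc lc \<omega>]]) simp
  then show ?thesis
    by (rule eventually_mono) blast
qed

text \<open>Almost surely the new point is not yet in the configuration, so it contributes an independent factor.\<close>

lemma Laplace_iid_points:
  assumes diffuse: "\<And>x. emeasure \<pi> {x} = 0" and f: "test_function f" "\<And>x. 0 \<le> f x"
  shows "(\<integral>\<omega>. exp (- pairing f \<omega>) \<partial>iid_points \<pi> n) = (\<integral>x. exp (- f x) \<partial>\<pi>) ^ n"
proof (induction n)
  case 0
  have m: "(\<lambda>\<omega>. exp (- pairing f \<omega>)) \<in> borel_measurable vague_borel"
    using pairing_measurable[OF f(1)] by simp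
  have "pairing f {} = 0"
    using pairing_eq_sum[OF f(1), of "{}" "{}"] by simp
  then show ?case
    using integral_return[OF _ m] by (simp add: space_vague_borel empty_configuration)
next
  case (Suc n)
  let ?t = "\<integral>x. exp (- f x) \<partial>\<pi>"
  have m: "(\<lambda>\<omega>. exp (- pairing f \<omega>)) \<in> borel_measurable vague_borel"
    using pairing_measurable[OF f(1)] by simp
  have fm: "f \<in> borel_measurable \<pi>"
    using test_function_borel[OF f(1)] measurable_cong_sets[OF sets_\<pi> refl] by blast
  have "(\<integral>\<omega>. exp (- pairing f \<omega>) \<partial>iid_points \<pi> (Suc n)) =
      (\<integral>\<omega>. \<integral>x. exp (- pairing f (insert x \<omega>)) \<partial>\<pi> \<partial>iid_points \<pi> n)"
    using f(2) by (intro integral_iid_points_Suc(2) m) simp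
  also have "\<dots> = (\<integral>\<omega>. ?t * exp (- pairing f \<omega>) \<partial>iid_points \<pi> n)"
  proof (rule Bochner_Integration.integral_cong[OF refl])
    fix \<omega> assume "\<omega> \<in> space (iid_points \<pi> n)"
    then have \<omega>: "\<omega> \<in> configurations" by (simp add: space_iid_points)
    have "(\<integral>x. exp (- pairing f (insert x \<omega>)) \<partial>\<pi>) = (\<integral>x. exp (- f x) * exp (- pairing f \<omega>) \<partial>\<pi>)"
    proof (rule integral_cong_AE)
      show "(\<lambda>x. exp (- pairing f (insert x \<omega>))) \<in> borel_measurable \<pi>"
        using measurable_compose[OF measurable_Pair2'[of \<omega> vague_borel \<pi>] insert_comp_measurable[OF m refl]] \<omega>
        by (simp add: space_vague_borel)
      show "AE x in \<pi>. exp (- pairing f (insert x \<omega>)) = exp (- f x) * exp (- pairing f \<omega>)"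
        using AE_not_in_configuration[OF diffuse \<omega>]
        by (rule eventually_mono) (simp add: pairing_insert[OF f(1) \<omega>] flip: exp_add)
    qed (use fm in simp)
    then show "(\<integral>x. exp (- pairing f (insert x \<omega>)) \<partial>\<pi>) = ?t * exp (- pairing f \<omega>)"
      by simp
  qed
  finally show ?case
    by (simp add: Suc del: iid_points.simps)
qed

lemma Laplace_poisson_mixture:
  assumes s: "0 < s" and diffuse: "\<And>x. emeasure \<pi> {x} = 0" and f: "test_function f" "\<And>x. 0 \<le> f x"
  shows "(\<integral>\<omega>. exp (- pairing f \<omega>) \<partial>poisson_mixture s \<pi>) = exp (s * ((\<integral>x. exp (- f x) \<partial>\<pi>) - 1))"
proof -
  have "(\<integral>\<omega>. exp (- pairing f \<omega>) \<partial>poisson_mixture s \<pi>) =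
      poisson_mean s (\<lambda>n. \<integral>\<omega>. exp (- pairing f \<omega>) \<partial>iid_points \<pi> n)"
    using pairing_measurable[OF f(1)] f(2) by (intro integral_poisson_mixture[OF s]) simp_all
  then show ?thesis
    by (simp add: Laplace_iid_points[OF diffuse f] poisson_mean_power[OF s])
qed

section \<open>The Poincare inequality for indicators\<close>

text \<open>For \<open>\<omega>\<close> fixed, the indicator takes values in \<open>{0, 1}\<close>, so the absolute value of its increment is the
square. The mean square is the squared mean plus the variance.\<close>

lemma mean_flip_eq:
  assumes A: "A \<in> sets vague_borel" and \<omega>: "\<omega> \<in> configurations"
  shows "mean_flip \<pi> A \<omega> = (hit_prob \<pi> A \<omega> - indicator A \<omega>)\<^sup>2 + hit_prob \<pi> A \<omega> * (1 - hit_prob \<pi> A \<omega>)"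
proof -
  interpret prob_space \<pi> by (rule \<pi>)
  have int: "integrable \<pi> (\<lambda>x. indicat_real A (insert x \<omega>))"
    by (rule unit_integrable[OF \<pi> hit_prob_unit(2)[OF A \<omega>]]) (simp add: indicator_def)
  show ?thesis
  proof (cases "\<omega> \<in> A")
    case True
    then have "mean_flip \<pi> A \<omega> = (\<integral>x. 1 - indicat_real A (insert x \<omega>) \<partial>\<pi>)"
      unfolding mean_flip_def by (intro Bochner_Integration.integral_cong) (auto simp: indicator_def)
    then show ?thesis
      using int True by (simp add: hit_prob_def prob_space power2_eq_square algebra_simps)
  next
    case False
    then have "mean_flip \<pi> A \<omega> = hit_prob \<pi> A \<omega>"
      unfolding mean_flip_def hit_prob_def by (intro Bochner_Integration.integral_cong) (auto simp: indicator_def)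
    then show ?thesis
      using False by (simp add: power2_eq_square algebra_simps)
  qed
qed

lemma mean_flip_measurable:
  assumes "A \<in> sets vague_borel"
  shows "mean_flip \<pi> A \<in> borel_measurable (vague_borel :: 'a set measure)"
proof -
  have "(\<lambda>\<omega>. (hit_prob \<pi> A \<omega> - indicator A \<omega>)\<^sup>2 + hit_prob \<pi> A \<omega> * (1 - hit_prob \<pi> A \<omega>)) \<in> borel_measurable vague_borel"
    using hit_prob_measurable[OF assms] assms by simp
  then show ?thesis
    by (subst measurable_cong) (auto simp: space_vague_borel mean_flip_eq[OF assms])
qed

lemma mean_flip_unit:
  assumes A: "A \<in> sets vague_borel" and \<omega>: "\<omega> \<in> configurations"
  shows "mean_flip \<pi> A \<omega> \<in> {0..1}"
  unfolding mean_flip_def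
  using hit_prob_unit(2)[OF A \<omega>] by (intro unit_integral[OF \<pi>]) (auto simp: indicator_def)

text \<open>The squared mean in \<open>mean_flip_eq\<close> is averaged over \<open>\<omega>\<close> by Jensen's inequality.\<close>

lemma mean_flip_iid_points:
  assumes A: "A \<in> sets vague_borel"
  shows "(\<integral>\<omega>. hit_prob \<pi> A \<omega> * (1 - hit_prob \<pi> A \<omega>) \<partial>iid_points \<pi> n)
      + (measure (iid_points \<pi> (Suc n)) A - measure (iid_points \<pi> n) A)\<^sup>2
    \<le> (\<integral>\<omega>. mean_flip \<pi> A \<omega> \<partial>iid_points \<pi> n)"
proof -
  let ?R = "iid_points \<pi> n" and ?q = "hit_prob \<pi> A"
  interpret R: prob_space ?R by (rule prob_space_iid_points)
  have qm: "?q \<in> borel_measurable ?R"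
    using hit_prob_measurable[OF A] measurable_cong_sets[OF sets_iid_points refl] by blast
  have Am: "indicat_real A \<in> borel_measurable ?R"
    using A sets_iid_points[of n] by (intro borel_measurable_indicator) simp
  have q01: "?q \<omega> \<in> {0..1}" if "\<omega> \<in> space ?R" for \<omega>
    using that hit_prob_unit(1)[OF A] by (simp add: space_iid_points)
  define X where "X \<omega> = ?q \<omega> - indicator A \<omega>" for \<omega>
  have iq: "integrable ?R ?q" and iA: "integrable ?R (indicat_real A)"
    and iv: "integrable ?R (\<lambda>\<omega>. ?q \<omega> * (1 - ?q \<omega>))"
    using qm Am q01 by (auto intro!: unit_integrable[OF prob_space_iid_points] mult_le_one simp: indicator_def)
  have iX: "integrable ?R X"
    unfolding X_def using iq iA by simp
  have "(X \<omega>)\<^sup>2 \<in> {0..1}" if "\<omega> \<in> space ?R" for \<omega>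
    using q01[OF that] by (auto simp: X_def indicator_def abs_square_le_1)
  then have iX2: "integrable ?R (\<lambda>\<omega>. (X \<omega>)\<^sup>2)"
    using iX by (intro unit_integrable[OF prob_space_iid_points]) auto
  have "(\<integral>\<omega>. X \<omega> \<partial>?R) = measure (iid_points \<pi> (Suc n)) A - measure ?R A"
    unfolding X_def measure_iid_points_Suc[OF A] using iq iA A
    by (simp add: sets.Int_space_eq2 sets_iid_points)
  moreover have "(\<integral>\<omega>. X \<omega> \<partial>?R)\<^sup>2 \<le> (\<integral>\<omega>. (X \<omega>)\<^sup>2 \<partial>?R)"
    using R.variance_eq[OF iX iX2] R.variance_positive[of X] by simp
  moreover have "(\<integral>\<omega>. mean_flip \<pi> A \<omega> \<partial>?R) = (\<integral>\<omega>. (X \<omega>)\<^sup>2 + ?q \<omega> * (1 - ?q \<omega>) \<partial>?R)"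
    by (intro Bochner_Integration.integral_cong) (simp_all add: mean_flip_eq[OF A] X_def space_iid_points)
  ultimately show ?thesis
    using iX2 iv by simp
qed

text \<open>In the notation of the proof, \<open>E a - (E a)\<^sup>2\<close> is the sum of \<open>E (a (1 - a))\<close>, the conditional variance
given the number of points, and \<open>E a\<^sup>2 - (E a)\<^sup>2\<close>, the variance of the conditional probability. They are
bounded by \<open>s E v\<close> and \<open>s E D\<close>.\<close>

lemma poincare_poisson_mixture:
  assumes s: "0 < s" and A: "A \<in> sets vague_borel"
  shows "measure (poisson_mixture s \<pi>) A * (1 - measure (poisson_mixture s \<pi>) A)
    \<le> s * (\<integral>\<omega>. mean_flip \<pi> A \<omega> \<partial>poisson_mixture s \<pi>)"
proof -
  let ?E = "poisson_mean s"
  define a where "a n = measure (iid_points \<pi> n) A" for n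
  define v where "v n = (\<integral>\<omega>. hit_prob \<pi> A \<omega> * (1 - hit_prob \<pi> A \<omega>) \<partial>iid_points \<pi> n)" for n
  define d where "d n = (\<integral>\<omega>. mean_flip \<pi> A \<omega> \<partial>iid_points \<pi> n)" for n
  define D where "D n = (a (Suc n) - a n)\<^sup>2" for n
  have meas: "h \<in> borel_measurable (iid_points \<pi> n)" if "h \<in> borel_measurable vague_borel" for h :: "_ \<Rightarrow> real" and n
    using that measurable_cong_sets[OF sets_iid_points refl] by blast
  have a01: "a n \<in> {0..1}" for n
    using prob_space.prob_le_1[OF prob_space_iid_points] by (simp add: a_def)
  have d01: "d n \<in> {0..1}" for n
    unfolding d_def using mean_flip_measurable[OF A] mean_flip_unit[OF A]
    by (intro unit_integral prob_space_iid_points meas) (simp_all add: space_iid_points)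
  have v01: "v n \<in> {0..1}" for n
    unfolding v_def
  proof (intro unit_integral prob_space_iid_points meas)
    show "(\<lambda>\<omega>. hit_prob \<pi> A \<omega> * (1 - hit_prob \<pi> A \<omega>)) \<in> borel_measurable vague_borel"
      using hit_prob_measurable[OF A] by simp
    show "hit_prob \<pi> A \<omega> * (1 - hit_prob \<pi> A \<omega>) \<in> {0..1}" if "\<omega> \<in> space (iid_points \<pi> n)" for \<omega>
      using that hit_prob_unit(1)[OF A, of \<omega>] by (auto simp: space_iid_points intro!: mult_le_one)
  qed
  have vD: "v n + D n \<le> d n" for n
    unfolding v_def D_def a_def d_def by (rule mean_flip_iid_points[OF A])
  have small: "\<bar>g\<bar> \<le> 4 ^ n" if "g \<in> {0..1}" for g :: real and n
    using that le_4_power(3)[of n] unfolding atLeastAtMost_iff by linarith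
  have D01: "D n \<in> {0..1}" for n
    using vD[of n] v01[of n] d01[of n] by (auto simp: D_def)
  have aa01: "(a n)\<^sup>2 \<in> {0..1}" "a n * (1 - a n) \<in> {0..1}" for n
    using a01[of n] by (auto simp: power_le_one intro!: mult_le_one)
  have nv: "\<bar>real n * v (n - 1)\<bar> \<le> 4 ^ n" for n
  proof -
    have "\<bar>real n * v (n - 1)\<bar> \<le> real n"
      using v01[of "n - 1"] by (simp add: abs_mult mult_left_le)
    then show ?thesis
      using le_4_power(1)[of n] by linarith
  qed
  have "measure (poisson_mixture s \<pi>) A = (\<integral>\<omega>. indicator A \<omega> \<partial>poisson_mixture s \<pi>)"
    using A by (simp add: sets.Int_space_eq2 sets_poisson_mixture)
  also have "\<dots> = ?E (\<lambda>n. \<integral>\<omega>. indicator A \<omega> \<partial>iid_points \<pi> n)"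
    using A by (intro integral_poisson_mixture[OF s]) (simp_all add: indicator_def)
  also have "\<dots> = ?E a"
    using A by (simp add: a_def[abs_def] sets.Int_space_eq2 sets_iid_points)
  finally have m: "measure (poisson_mixture s \<pi>) A = ?E a" .
  have md: "(\<integral>\<omega>. mean_flip \<pi> A \<omega> \<partial>poisson_mixture s \<pi>) = ?E d"
    unfolding d_def[abs_def] using mean_flip_measurable[OF A] mean_flip_unit[OF A]
    by (rule integral_poisson_mixture[OF s])
  have "?E a = ?E (\<lambda>n. a n * (1 - a n) + (a n)\<^sup>2)"
    by (simp add: power2_eq_square right_diff_distrib)
  also have "\<dots> = ?E (\<lambda>n. a n * (1 - a n)) + ?E (\<lambda>n. (a n)\<^sup>2)"
    by (rule poisson_mean_add[OF s small[OF aa01(2)] small[OF aa01(1)]])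
  finally have "?E a = ?E (\<lambda>n. a n * (1 - a n)) + ?E (\<lambda>n. (a n)\<^sup>2)" .
  moreover have "?E (\<lambda>n. a n * (1 - a n)) \<le> ?E (\<lambda>n. real n * v (n - 1))"
    using efron_stein_iid_points[OF A]
    by (intro poisson_mean_mono[OF s small[OF aa01(2)] nv]) (simp add: a_def v_def)
  moreover have "?E (\<lambda>n. real n * v (n - 1)) = s * ?E v"
    using poisson_mean_Suc[OF s nv] by simp
  moreover have "?E (\<lambda>n. (a n)\<^sup>2) - (?E a)\<^sup>2 \<le> s * ?E D"
    unfolding D_def[abs_def] by (rule poisson_poincare_nat[OF s a01])
  moreover have "s * (?E v + ?E D) \<le> s * ?E d"
  proof -
    have "?E (\<lambda>n. v n + D n) \<le> ?E d"
    proof (rule poisson_mean_mono[OF s small small[OF d01] vD])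
      show "v n + D n \<in> {0..1}" for n
        using vD[of n] v01[of n] D01[of n] d01[of n] unfolding atLeastAtMost_iff by linarith
    qed
    moreover have "?E (\<lambda>n. v n + D n) = ?E v + ?E D"
      by (rule poisson_mean_add[OF s small[OF v01] small[OF D01]])
    ultimately show ?thesis
      using s by simp
  qed
  ultimately show ?thesis
    unfolding m md by (simp add: power2_eq_square algebra_simps)
qed

end

section \<open>The isoperimetric constant\<close>

definition normalised :: "'a measure \<Rightarrow> 'a measure" where
  "normalised \<sigma> = density \<sigma> (\<lambda>_. ennreal (1 / measure \<sigma> UNIV))"

context
  fixes \<sigma> :: "'a::metric_space measure" and \<mu> :: "'a set measure"
  assumes sc: "sigma_compact (UNIV :: 'a set)"
    and lc: "locally compact (UNIV :: 'a set)"
    and sets_\<sigma>: "sets \<sigma> = sets borel"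
    and diffuse: "diffuse \<sigma>"
    and pos: "0 < emeasure \<sigma> UNIV" and fin: "emeasure \<sigma> UNIV < \<infinity>"
    and poisson: "is_poisson_measure \<sigma> \<mu>"
begin

lemma space_\<sigma>: "space \<sigma> = UNIV"
  using sets_eq_imp_space_eq[OF sets_\<sigma>] by simp

lemma finite_\<sigma>: "finite_measure \<sigma>"
  using fin by (intro finite_measureI) (simp add: space_\<sigma>)

lemma mass_pos: "0 < measure \<sigma> UNIV"
  using pos fin by (simp add: measure_def enn2real_positive_iff)

lemma emeasure_mass: "emeasure \<sigma> UNIV = ennreal (measure \<sigma> UNIV)"
  using finite_measure.emeasure_eq_measure[OF finite_\<sigma>] by blast

lemma sets_normalised: "sets (normalised \<sigma>) = sets borel"
  by (simp add: normalised_def sets_\<sigma>)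

lemma prob_space_normalised: "prob_space (normalised \<sigma>)"
proof
  have "emeasure (normalised \<sigma>) UNIV = ennreal (1 / measure \<sigma> UNIV) * emeasure \<sigma> UNIV"
    unfolding normalised_def using sets_\<sigma> by (intro emeasure_density_const) simp
  also have "\<dots> = 1"
    unfolding emeasure_mass using mass_pos by (simp flip: ennreal_mult)
  finally show "emeasure (normalised \<sigma>) (space (normalised \<sigma>)) = 1"
    by (simp add: normalised_def space_\<sigma>)
qed

lemma diffuse_normalised: "emeasure (normalised \<sigma>) {x} = 0"
proof -
  have "emeasure (normalised \<sigma>) {x} = ennreal (1 / measure \<sigma> UNIV) * emeasure \<sigma> {x}"
    unfolding normalised_def using sets_\<sigma> by (intro emeasure_density_const) simp
  then show ?thesis
    using diffuse by (simp add: diffuse_def space_\<sigma>)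
qed

lemma integral_normalised:
  fixes h :: "'a \<Rightarrow> real"
  assumes "h \<in> borel_measurable \<sigma>"
  shows "(\<integral>x. h x \<partial>\<sigma>) = measure \<sigma> UNIV * (\<integral>x. h x \<partial>normalised \<sigma>)"
proof -
  have "(\<integral>x. h x \<partial>normalised \<sigma>) = (\<integral>x. (1 / measure \<sigma> UNIV) *\<^sub>R h x \<partial>\<sigma>)"
    unfolding normalised_def using assms by (intro integral_density) simp_all
  then show ?thesis
    using mass_pos by simp
qed

lemmas iid_facts = sc lc prob_space_normalised sets_normalised

text \<open>With \<open>t\<close> the mean of \<open>exp (- f)\<close> under the normalised measure, both Laplace functionals equal
\<open>exp (s (t - 1))\<close>.\<close>

lemma poisson_measure_eq_mixture: "\<mu> = poisson_mixture (measure \<sigma> UNIV) (normalised \<sigma>)"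
proof (rule Laplace_functional_unique[OF sc lc])
  show "prob_space \<mu>" "sets \<mu> = sets vague_borel"
    using poisson by (simp_all add: is_poisson_measure_def)
  show "prob_space (poisson_mixture (measure \<sigma> UNIV) (normalised \<sigma>))"
    by (rule prob_space_poisson_mixture[OF iid_facts])
  show "sets (poisson_mixture (measure \<sigma> UNIV) (normalised \<sigma>)) = sets vague_borel"
    by (rule sets_poisson_mixture[OF iid_facts])
  fix f :: "'a \<Rightarrow> real" assume f: "test_function f" and f0: "\<And>x. 0 \<le> f x"
  interpret finite_measure \<sigma> by (rule finite_\<sigma>)
  have fm: "f \<in> borel_measurable \<sigma>"
    using test_function_borel[OF f] measurable_cong_sets[OF sets_\<sigma> refl] by blast
  have int: "integrable \<sigma> (\<lambda>x. exp (- f x))"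
    using fm f0 by (intro integrable_const_bound[where B = 1]) auto
  have "test_function (\<lambda>x. - f x)"
    using test_function_scale[OF f, of "- 1"] by simp
  then have "(\<integral>\<omega>. exp (pairing (\<lambda>x. - f x) \<omega>) \<partial>\<mu>) = exp (\<integral>x. (exp (- f x) - 1) \<partial>\<sigma>)"
    using poisson unfolding is_poisson_measure_def test_function_def by blast
  then have "(\<integral>\<omega>. exp (- pairing f \<omega>) \<partial>\<mu>) = exp (\<integral>x. (exp (- f x) - 1) \<partial>\<sigma>)"
    by simp
  also have "(\<integral>x. (exp (- f x) - 1) \<partial>\<sigma>) = (\<integral>x. exp (- f x) \<partial>\<sigma>) - measure \<sigma> UNIV"
    using int by (simp add: space_\<sigma>)
  also have "\<dots> = measure \<sigma> UNIV * ((\<integral>x. exp (- f x) \<partial>normalised \<sigma>) - 1)"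
    using integral_normalised[of "\<lambda>x. exp (- f x)"] fm by (simp add: right_diff_distrib)
  also have "exp \<dots> = (\<integral>\<omega>. exp (- pairing f \<omega>) \<partial>poisson_mixture (measure \<sigma> UNIV) (normalised \<sigma>))"
    by (rule Laplace_poisson_mixture[OF iid_facts mass_pos diffuse_normalised f f0, symmetric])
  finally show "(\<integral>\<omega>. exp (- pairing f \<omega>) \<partial>\<mu>) =
      (\<integral>\<omega>. exp (- pairing f \<omega>) \<partial>poisson_mixture (measure \<sigma> UNIV) (normalised \<sigma>))" .
qed

lemma sets_\<mu>: "sets \<mu> = sets vague_borel"
  using poisson by (simp add: is_poisson_measure_def)

lemma prob_space_\<mu>: "prob_space \<mu>"
  using poisson by (simp add: is_poisson_measure_def)

lemma surface_measure_eq: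
  assumes A: "A \<in> sets \<mu>"
  shows "surface_measure \<sigma> \<mu> A = ennreal (measure \<sigma> UNIV * (\<integral>\<omega>. mean_flip (normalised \<sigma>) A \<omega> \<partial>\<mu>))"
proof -
  interpret S: finite_measure \<sigma> by (rule finite_\<sigma>)
  have A': "A \<in> sets vague_borel"
    using A by (simp add: sets_\<mu>)
  have sp: "space \<mu> = configurations"
    using sets_eq_imp_space_eq[OF sets_\<mu>] by (simp add: space_vague_borel)
  have fm: "mean_flip (normalised \<sigma>) A \<in> borel_measurable \<mu>"
    using mean_flip_measurable[OF iid_facts A'] measurable_cong_sets[OF sets_\<mu> refl] by blast
  have f01: "mean_flip (normalised \<sigma>) A \<omega> \<in> {0..1}" if "\<omega> \<in> space \<mu>" for \<omega>
    using mean_flip_unit[OF iid_facts A'] that by (simp add: sp)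
  have "surface_measure \<sigma> \<mu> A = (\<integral>\<^sup>+\<omega>. ennreal (measure \<sigma> UNIV * mean_flip (normalised \<sigma>) A \<omega>) \<partial>\<mu>)"
    unfolding surface_measure_def
  proof (rule nn_integral_cong)
    fix \<omega> assume "\<omega> \<in> space \<mu>"
    then have "(\<lambda>x. indicat_real A (insert x \<omega>)) \<in> borel_measurable (normalised \<sigma>)"
      by (intro hit_prob_unit(2)[OF iid_facts A']) (simp add: sp)
    then have m: "(\<lambda>x. \<bar>discrete_gradient x (indicat_real A) \<omega>\<bar>) \<in> borel_measurable \<sigma>"
      by (simp add: discrete_gradient_def normalised_def)
    have "integrable \<sigma> (\<lambda>x. \<bar>discrete_gradient x (indicat_real A) \<omega>\<bar>)"
      using m by (intro S.integrable_const_bound[where B = 1]) (auto simp: discrete_gradient_def indicator_def)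
    then have "(\<integral>\<^sup>+x. ennreal \<bar>discrete_gradient x (indicat_real A) \<omega>\<bar> \<partial>\<sigma>) =
        ennreal (\<integral>x. \<bar>discrete_gradient x (indicat_real A) \<omega>\<bar> \<partial>\<sigma>)"
      by (intro nn_integral_eq_integral) simp_all
    also have "(\<integral>x. \<bar>discrete_gradient x (indicat_real A) \<omega>\<bar> \<partial>\<sigma>) = measure \<sigma> UNIV * mean_flip (normalised \<sigma>) A \<omega>"
      unfolding integral_normalised[OF m] by (simp add: mean_flip_def discrete_gradient_def)
    finally show "(\<integral>\<^sup>+x. ennreal \<bar>discrete_gradient x (indicat_real A) \<omega>\<bar> \<partial>\<sigma>) =
        ennreal (measure \<sigma> UNIV * mean_flip (normalised \<sigma>) A \<omega>)" .
  qed
  also have "\<dots> = ennreal (\<integral>\<omega>. measure \<sigma> UNIV * mean_flip (normalised \<sigma>) A \<omega> \<partial>\<mu>)"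
    using unit_integrable[OF prob_space_\<mu> fm f01] f01
    by (intro nn_integral_eq_integral integrable_mult_right AE_I2) simp_all
  finally show ?thesis
    by simp
qed

lemma one_le_isoperimetric_constant: "1 \<le> isoperimetric_constant \<sigma> \<mu>"
  unfolding isoperimetric_constant_def
proof (rule INF_greatest)
  fix A assume "A \<in> {A \<in> sets \<mu>. 0 < measure \<mu> A \<and> measure \<mu> A < 1}"
  then have A: "A \<in> sets \<mu>" and v: "0 < measure \<mu> A * (1 - measure \<mu> A)"
    by simp_all
  let ?S = "measure \<sigma> UNIV * (\<integral>\<omega>. mean_flip (normalised \<sigma>) A \<omega> \<partial>\<mu>)"
  have "A \<in> sets vague_borel"
    using A by (simp add: sets_\<mu>)
  then have le: "measure \<mu> A * (1 - measure \<mu> A) \<le> ?S"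
    using poincare_poisson_mixture[OF iid_facts mass_pos] unfolding poisson_measure_eq_mixture[symmetric] by blast
  then have "surface_measure \<sigma> \<mu> A / ennreal (measure \<mu> A * (1 - measure \<mu> A)) =
      ennreal (?S / (measure \<mu> A * (1 - measure \<mu> A)))"
    unfolding surface_measure_eq[OF A] using v by (intro divide_ennreal) simp_all
  moreover have "1 \<le> ?S / (measure \<mu> A * (1 - measure \<mu> A))"
    using le v by (subst le_divide_eq_1_pos) simp_all
  ultimately show "1 \<le> surface_measure \<sigma> \<mu> A / ennreal (measure \<mu> A * (1 - measure \<mu> A))"
    by simp
qed

text \<open>Only \<open>n = 0\<close> points give the empty configuration, so this is the Poisson mean of \<open>0 ^ n\<close>.\<close>

lemma void_probability: "measure \<mu> {{}} = exp (- measure \<sigma> UNIV)"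
proof -
  let ?\<pi> = "normalised \<sigma>"
  note void = empty_configuration_measurable[OF sc lc]
  have "measure (iid_points ?\<pi> n) {{}} = 0 ^ n" for n
  proof (cases n)
    case 0
    then show ?thesis
      using void by (simp add: measure_return)
  next
    case (Suc k)
    have "hit_prob ?\<pi> {{}} \<omega> = 0" for \<omega>
      by (simp add: hit_prob_def indicator_def)
    then show ?thesis
      using measure_iid_points_Suc[OF iid_facts void, of k] by (simp add: Suc del: iid_points.simps)
  qed
  then have "(\<integral>\<omega>. indicat_real {{}} \<omega> \<partial>iid_points ?\<pi> n) = 0 ^ n" for n
    using void by (simp add: sets.Int_space_eq2 sets_iid_points[OF iid_facts] del: iid_points.simps)
  moreover have "measure \<mu> {{}} = (\<integral>\<omega>. indicat_real {{}} \<omega> \<partial>\<mu>)"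
    using void by (simp add: sets.Int_space_eq2 sets_\<mu>)
  moreover have "\<dots> = poisson_mean (measure \<sigma> UNIV) (\<lambda>n. \<integral>\<omega>. indicat_real {{}} \<omega> \<partial>iid_points ?\<pi> n)"
    using void unfolding poisson_measure_eq_mixture
    by (intro integral_poisson_mixture[OF iid_facts mass_pos]) (simp_all add: indicator_def)
  ultimately show ?thesis
    using poisson_mean_power[OF mass_pos, of 0] by simp
qed

text \<open>The bound is the value of the quotient at the event of having no points. Adding a point always leaves
this event, so its \<open>mean_flip\<close> is its indicator.\<close>

lemma isoperimetric_constant_le:
  "isoperimetric_constant \<sigma> \<mu> \<le> ennreal (measure \<sigma> UNIV / (1 - exp (- measure \<sigma> UNIV)))"
proof -
  let ?s = "measure \<sigma> UNIV"
  have void: "{{}} \<in> sets \<mu>"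
    using empty_configuration_measurable[OF sc lc] by (simp add: sets_\<mu>)
  have "mean_flip (normalised \<sigma>) {{}} \<omega> = indicator {{}} \<omega>" for \<omega>
  proof -
    interpret prob_space "normalised \<sigma>" by (rule prob_space_normalised)
    show ?thesis
      by (simp add: mean_flip_def prob_space)
  qed
  then have "(\<integral>\<omega>. mean_flip (normalised \<sigma>) {{}} \<omega> \<partial>\<mu>) = exp (- ?s)"
    using void by (simp add: sets.Int_space_eq2 void_probability)
  then have "surface_measure \<sigma> \<mu> {{}} / ennreal (measure \<mu> {{}} * (1 - measure \<mu> {{}})) =
      ennreal (?s * exp (- ?s)) / ennreal (exp (- ?s) * (1 - exp (- ?s)))"
    by (simp add: surface_measure_eq[OF void] void_probability)
  also have "\<dots> = ennreal (?s / (1 - exp (- ?s)))"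
    using mass_pos by (subst divide_ennreal) simp_all
  finally have "surface_measure \<sigma> \<mu> {{}} / ennreal (measure \<mu> {{}} * (1 - measure \<mu> {{}})) =
      ennreal (?s / (1 - exp (- ?s)))" .
  moreover have "isoperimetric_constant \<sigma> \<mu> \<le> surface_measure \<sigma> \<mu> {{}} / ennreal (measure \<mu> {{}} * (1 - measure \<mu> {{}}))"
    unfolding isoperimetric_constant_def using void mass_pos by (intro INF_lower) (simp add: void_probability)
  ultimately show ?thesis
    by simp
qed

end

text \<open>The limit is taken in the extended mass \<open>\<sigma>(\<Lambda>)\<close>, which is finite close to \<open>0\<close>.\<close>

lemma tendsto_upper_bound:
  "((\<lambda>e. ennreal (enn2real e / (1 - exp (- enn2real e)))) \<longlongrightarrow> 1) (at_right 0)"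
proof -
  have "filterlim enn2real (at_right 0) (at_right (0::ennreal))"
    unfolding filterlim_at
  proof
    show "\<forall>\<^sub>F e in at_right 0. enn2real e \<in> {0<..} \<and> enn2real e \<noteq> 0"
      unfolding eventually_at_right[OF zero_less_one]
    proof (intro exI[of _ 1] conjI allI impI)
      fix e :: ennreal assume "0 < e" "e < 1"
      then have "0 < enn2real e"
        using less_trans[OF _ ennreal_one_less_top] by (simp add: enn2real_positive_iff)
      then show "enn2real e \<in> {0<..}" "enn2real e \<noteq> 0"
        by simp_all
    qed simp
    show "(enn2real \<longlongrightarrow> 0) (at_right (0::ennreal))"
      using tendsto_enn2real[of "\<lambda>e. e" 0 "at_right 0"] by (simp add: tendsto_ident_at)
  qed
  moreover have "((\<lambda>x::real. x / (1 - exp (- x))) \<longlongrightarrow> 1) (at_right 0)"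
    by real_asymp
  ultimately have "((\<lambda>e. enn2real e / (1 - exp (- enn2real e))) \<longlongrightarrow> 1) (at_right (0::ennreal))"
    by (rule filterlim_compose[rotated])
  from tendsto_ennrealI[OF this] show ?thesis
    by simp
qed

theorem proposition4p7:
  assumes "sigma_compact (UNIV :: 'a::metric_space set)"
    and "locally compact (UNIV :: 'a set)"
  shows "(\<forall>(\<sigma> :: 'a measure) \<mu>.
            radon_measure \<sigma> \<and> diffuse \<sigma> \<and>
            0 < emeasure \<sigma> UNIV \<and> emeasure \<sigma> UNIV < \<infinity> \<and>
            is_poisson_measure \<sigma> \<mu> \<longrightarrow>
              1 \<le> isoperimetric_constant \<sigma> \<mu> \<and>
              isoperimetric_constant \<sigma> \<mu>
                \<le> ennreal (measure \<sigma> UNIV / (1 - exp (- measure \<sigma> UNIV))))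
       \<and> ((\<lambda>(\<sigma> :: 'a measure, \<mu>). isoperimetric_constant \<sigma> \<mu>) \<longlongrightarrow> 1)
            (inf (filtercomap (\<lambda>(\<sigma>, \<mu>). emeasure \<sigma> UNIV) (at_right 0))
                 (principal {(\<sigma>, \<mu>). radon_measure \<sigma> \<and> diffuse \<sigma> \<and> is_poisson_measure \<sigma> \<mu>}))"
proof -
  have bounds: "1 \<le> isoperimetric_constant \<sigma> \<mu> \<and>
      isoperimetric_constant \<sigma> \<mu> \<le> ennreal (measure \<sigma> UNIV / (1 - exp (- measure \<sigma> UNIV)))"
    if "radon_measure \<sigma> \<and> diffuse \<sigma> \<and> 0 < emeasure \<sigma> UNIV \<and> emeasure \<sigma> UNIV < \<infinity> \<and> is_poisson_measure \<sigma> \<mu>"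
    for \<sigma> :: "'a measure" and \<mu>
  proof -
    have "sets \<sigma> = sets borel"
      using that by (simp add: radon_measure_def)
    then show ?thesis
      using that one_le_isoperimetric_constant[OF assms, of \<sigma> \<mu>] isoperimetric_constant_le[OF assms, of \<sigma> \<mu>]
      by blast
  qed
  define I where "I = (\<lambda>(\<sigma> :: 'a measure, \<mu>). isoperimetric_constant \<sigma> \<mu>)"
  let ?mass = "\<lambda>(\<sigma> :: 'a measure, \<mu> :: 'a set measure). emeasure \<sigma> UNIV"
  let ?S = "{(\<sigma> :: 'a measure, \<mu>). radon_measure \<sigma> \<and> diffuse \<sigma> \<and> is_poisson_measure \<sigma> \<mu>}"
  let ?F = "inf (filtercomap ?mass (at_right 0)) (principal ?S)"
  let ?u = "\<lambda>e. ennreal (enn2real e / (1 - exp (- enn2real e)))"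
  have "\<forall>\<^sub>F e in at_right (0::ennreal). 0 < e \<and> e < 1"
    unfolding eventually_at_right[OF zero_less_one] by (intro exI[of _ 1]) simp
  then have "\<forall>\<^sub>F p in filtercomap ?mass (at_right 0). 0 < ?mass p \<and> ?mass p < 1"
    by (rule eventually_filtercomapI)
  then have "\<forall>\<^sub>F p in ?F. 1 \<le> I p \<and> I p \<le> ?u (?mass p)"
    unfolding eventually_inf_principal
  proof (rule eventually_mono)
    fix p assume p: "0 < ?mass p \<and> ?mass p < 1"
    obtain \<sigma> \<mu> where eq: "p = (\<sigma>, \<mu>)" by (cases p)
    show "p \<in> ?S \<longrightarrow> 1 \<le> I p \<and> I p \<le> ?u (?mass p)"
      using p bounds[of \<sigma> \<mu>] less_trans[OF _ ennreal_one_less_top, of "emeasure \<sigma> UNIV"]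
      by (simp add: I_def eq measure_def)
  qed
  then have ev: "\<forall>\<^sub>F p in ?F. 1 \<le> I p" "\<forall>\<^sub>F p in ?F. I p \<le> ?u (?mass p)"
    unfolding eventually_conj_iff by (rule conjunct1, rule conjunct2)
  have "((\<lambda>p. ?u (?mass p)) \<longlongrightarrow> 1) (filtercomap ?mass (at_right 0))"
    by (rule filterlim_compose[OF tendsto_upper_bound filterlim_filtercomap])
  then have "((\<lambda>p. ?u (?mass p)) \<longlongrightarrow> 1) ?F"
    by (rule filterlim_mono) (rule order_refl, rule inf_le1)
  then have "(I \<longlongrightarrow> 1) ?F"
    by (rule tendsto_sandwich[OF ev tendsto_const])
  then have lim: "((\<lambda>(\<sigma> :: 'a measure, \<mu>). isoperimetric_constant \<sigma> \<mu>) \<longlongrightarrow> 1) ?F"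
    unfolding I_def .
  show ?thesis
    by (rule conjI[OF _ lim]) (intro allI impI, rule bounds)
qed

end
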